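(* Let $k$ be a field, let $A=TV/(R)$, with $V$ a finite dimensional $k$-vector space and $R\subset V^{\otimes 2}$, be a quadratic Koszul algebra, let $N\ge 2$, and let $R'\in\mathcal{L}_N(A)$, where $\mathcal{L}_N(A)$ is the lattice of subspaces of $V^{\otimes N}$ generated by the subspaces $V^{\otimes i-1}\otimes R\otimes V^{\otimes N-i-1}$, $1\le i\le N-1$. Then $A'=TV/(R')$ is a distributive algebra. If specifically one takes $$R'=\bigcap_{i=1}^{N-1}V^{\otimes i-1}\otimes R\otimes V^{\otimes N-i-1},$$ then $A'$ also satisfies the extra condition and hence is $N$-Koszul.
   Context: Let $B=TV/(R')$ with $R'\subset V^{\otimes N}$. For $n\ge N$ and $1\le i\le n-N+1$ put $R'^{(n)}_i=V^{\otimes i-1}\otimes R'\otimes V^{\otimes n-N-i+1}\subset V^{\otimes n}$. $B$ is *distributive* if for each $n$ the lattice of subspaces of $V^{\otimes n}$ generated by $(R'^{(n)}_i)_i$ is distributive. $B$ satisfies the *extra condition* if for all $n\ge N$ and all $1\le i\le l\le j\le n-N+1$ with $j\le i+N-1$ one has $R'^{(n)}_i\cap R'^{(n)}_j\subset R'^{(n)}_l$. Put $J_n=R'^{(n)}_1\cap\cdots\cap R'^{(n)}_{n-N+1}$ for $n\ge N$ and $J_n=V^{\otimes n}$ for $n\le N-1$. Let $\delta:B\otimes J_n\to B\otimes V\otimes J_{n-1}\to B\otimes J_{n-1}$ be the composition of the map induced by $J_n\subset V\otimes J_{n-1}$ and the map induced by multiplication $B\otimes V\to B$; one has $\delta^N=0$.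 $B$ is *$N$-Koszul* if the complex $$\cdots\to B\otimes J_{2N}\xrightarrow{\delta^{N-1}}B\otimes J_{N+1}\xrightarrow{\delta}B\otimes R'\xrightarrow{\delta^{N-1}}B\otimes V\xrightarrow{\delta}B\to k$$ is exact. For $N=2$ this is the usual Koszul property of quadratic algebras. *)

theory Defs
  imports
    "HOL.Vector_Spaces"
    "HOL-Library.Function_Algebras"
    "HOL-Library.Set_Algebras"
    "HOL-Algebra.QuotRing"
begin

text \<open>
  The tensor algebra of a finite dimensional vector space \<open>V\<close> (the type \<open>'v\<close> with scalar
  multiplication \<open>s\<close> and basis \<open>B\<close>). A tensor is given by its coordinates: the value of
  \<open>t :: ('v, 'k) tensor\<close> at the word \<open>[b\<^sub>1, \<dots>, b\<^sub>n]\<close> of basis vectors is the coefficient of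
  \<open>b\<^sub>1 \<otimes> \<dots> \<otimes> b\<^sub>n\<close>. Addition is pointwise, and the tensor product, which is the product
  of the tensor algebra, becomes convolution along concatenation of words.
\<close>

type_synonym ('v, 'k) tensor = "'v list \<Rightarrow> 'k"

definition tscale :: "'k::field \<Rightarrow> ('v, 'k) tensor \<Rightarrow> ('v, 'k) tensor" where
  "tscale c t = (\<lambda>w. c * t w)"

definition tmult :: "('v, 'k::field) tensor \<Rightarrow> ('v, 'k) tensor \<Rightarrow> ('v, 'k) tensor" where
  "tmult t u = (\<lambda>w. \<Sum>i\<le>length w. t (take i w) * u (drop i w))"

definition tone :: "('v, 'k::field) tensor" where
  "tone = (\<lambda>w. if w = [] then 1 else 0)"

definition vec :: "('k::field \<Rightarrow> 'v::ab_group_add \<Rightarrow> 'v) \<Rightarrow> 'v set \<Rightarrow> 'v \<Rightarrow> ('v, 'k) tensor" where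
  "vec s B v = (\<lambda>w. case w of [b] \<Rightarrow> module.representation s B v b | _ \<Rightarrow> 0)"

abbreviation tspan :: "('v, 'k::field) tensor set \<Rightarrow> ('v, 'k) tensor set" where
  "tspan \<equiv> module.span tscale"

abbreviation tsubspace :: "('v, 'k::field) tensor set \<Rightarrow> bool" where
  "tsubspace \<equiv> module.subspace tscale"

text \<open>\<open>U \<otimes> W\<close>, used for \<open>U \<subseteq> V\<^bsup>\<otimes>m\<^esup>\<close> and \<open>W \<subseteq> V\<^bsup>\<otimes>n\<^esup>\<close>, as a subspace of \<open>V\<^bsup>\<otimes>m+n\<^esup>\<close>.\<close>

definition tprod :: "('v, 'k::field) tensor set \<Rightarrow> ('v, 'k) tensor set \<Rightarrow> ('v, 'k) tensor set" where
  "tprod U W = tspan {tmult u w | u w. u \<in> U \<and> w \<in> W}"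

primrec Vpow :: "('k::field \<Rightarrow> 'v::ab_group_add \<Rightarrow> 'v) \<Rightarrow> 'v set \<Rightarrow> nat \<Rightarrow> ('v, 'k) tensor set" where
  "Vpow s B 0 = tspan {tone}"
| "Vpow s B (Suc n) = tprod (range (vec s B)) (Vpow s B n)"

definition tensor_algebra ::
  "('k::field \<Rightarrow> 'v::ab_group_add \<Rightarrow> 'v) \<Rightarrow> 'v set \<Rightarrow> ('v, 'k) tensor ring" where
  "tensor_algebra s B =
    \<lparr>carrier = tspan (\<Union>n. Vpow s B n), mult = tmult, one = tone, zero = 0, add = (+)\<rparr>"


section \<open>Distributivity and the extra condition\<close>

text \<open>The lattice operations on subspaces are intersection and sum \<open>U + W = {u + w}\<close>.\<close>

inductive_set lattice_gen :: "'a::plus set set \<Rightarrow> 'a set set" for G where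
  base: "X \<in> G \<Longrightarrow> X \<in> lattice_gen G"
| inf: "X \<in> lattice_gen G \<Longrightarrow> Y \<in> lattice_gen G \<Longrightarrow> X \<inter> Y \<in> lattice_gen G"
| sum: "X \<in> lattice_gen G \<Longrightarrow> Y \<in> lattice_gen G \<Longrightarrow> X + Y \<in> lattice_gen G"

definition distributive_lattice :: "'a::plus set set \<Rightarrow> bool" where
  "distributive_lattice L \<longleftrightarrow>
    (\<forall>X\<in>L. \<forall>Y\<in>L. \<forall>Z\<in>L. X \<inter> (Y + Z) = (X \<inter> Y) + (X \<inter> Z))"

text \<open>\<open>V\<^bsup>\<otimes>i-1\<^esup> \<otimes> R \<otimes> V\<^bsup>\<otimes>n-N-i+1\<^esup>\<close> for \<open>R \<subseteq> V\<^bsup>\<otimes>N\<^esup>\<close> and \<open>1 \<le> i \<le> n - N + 1\<close>. The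
  differences are written so that truncated subtraction does no harm; in particular
  \<open>{1..n + 1 - N}\<close> is empty for \<open>n < N\<close>.\<close>

definition place :: "('k::field \<Rightarrow> 'v::ab_group_add \<Rightarrow> 'v) \<Rightarrow> 'v set \<Rightarrow> nat \<Rightarrow>
    ('v, 'k) tensor set \<Rightarrow> nat \<Rightarrow> nat \<Rightarrow> ('v, 'k) tensor set" where
  "place s B N R n i = tprod (tprod (Vpow s B (i - 1)) R) (Vpow s B (n + 1 - N - i))"

definition relation_lattice :: "('k::field \<Rightarrow> 'v::ab_group_add \<Rightarrow> 'v) \<Rightarrow> 'v set \<Rightarrow> nat \<Rightarrow>
    ('v, 'k) tensor set \<Rightarrow> nat \<Rightarrow> ('v, 'k) tensor set set" where
  "relation_lattice s B N R n = lattice_gen (place s B N R n ` {1..n + 1 - N})"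

definition distributive_algebra :: "('k::field \<Rightarrow> 'v::ab_group_add \<Rightarrow> 'v) \<Rightarrow> 'v set \<Rightarrow> nat \<Rightarrow>
    ('v, 'k) tensor set \<Rightarrow> bool" where
  "distributive_algebra s B N R \<longleftrightarrow> (\<forall>n. distributive_lattice (relation_lattice s B N R n))"

definition extra_condition :: "('k::field \<Rightarrow> 'v::ab_group_add \<Rightarrow> 'v) \<Rightarrow> 'v set \<Rightarrow> nat \<Rightarrow>
    ('v, 'k) tensor set \<Rightarrow> bool" where
  "extra_condition s B N R \<longleftrightarrow>
    (\<forall>n\<ge>N. \<forall>i l j. 1 \<le> i \<and> i \<le> l \<and> l \<le> j \<and> j \<le> n + 1 - N \<and> j \<le> i + N - 1 \<longrightarrow>
      place s B N R n i \<inter> place s B N R n j \<subseteq> place s B N R n l)"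


section \<open>The Koszul complex\<close>

definition quotient_algebra :: "('k::field \<Rightarrow> 'v::ab_group_add \<Rightarrow> 'v) \<Rightarrow> 'v set \<Rightarrow>
    ('v, 'k) tensor set \<Rightarrow> ('v, 'k) tensor set ring" where
  "quotient_algebra s B R = tensor_algebra s B Quot (Idl\<^bsub>tensor_algebra s B\<^esub> R)"

definition quotient_class :: "('k::field \<Rightarrow> 'v::ab_group_add \<Rightarrow> 'v) \<Rightarrow> 'v set \<Rightarrow>
    ('v, 'k) tensor set \<Rightarrow> ('v, 'k) tensor \<Rightarrow> ('v, 'k) tensor set" where
  "quotient_class s B R t = (Idl\<^bsub>tensor_algebra s B\<^esub> R) +>\<^bsub>tensor_algebra s B\<^esub> t"

definition quotient_scale :: "('k::field \<Rightarrow> 'v::ab_group_add \<Rightarrow> 'v) \<Rightarrow> 'v set \<Rightarrow>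
    ('v, 'k) tensor set \<Rightarrow> 'k \<Rightarrow> ('v, 'k) tensor set \<Rightarrow> ('v, 'k) tensor set" where
  "quotient_scale s B R c a =
    quotient_class s B R (tscale c tone) \<otimes>\<^bsub>quotient_algebra s B R\<^esub> a"

definition J :: "('k::field \<Rightarrow> 'v::ab_group_add \<Rightarrow> 'v) \<Rightarrow> 'v set \<Rightarrow> nat \<Rightarrow>
    ('v, 'k) tensor set \<Rightarrow> nat \<Rightarrow> ('v, 'k) tensor set" where
  "J s B N R n = (if n < N then Vpow s B n else (\<Inter>i\<in>{1..n + 1 - N}. place s B N R n i))"

text \<open>
  Write \<open>A = TV/(R)\<close>. As \<open>V\<^bsup>\<otimes>n\<^esup>\<close> has the words of length \<open>n\<close> as a basis,
  \<open>A \<otimes> V\<^bsup>\<otimes>n\<^esup>\<close> is the space of \<open>A\<close>-valued functions \<open>F\<close> on these words, \<open>F\<close> standing for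
  \<open>\<Sum>w. F w \<otimes> w\<close>, and \<open>a \<otimes> t\<close> is the function \<open>\<lambda>w. t w \<cdot> a\<close>. For a subspace \<open>W\<close> of
  \<open>V\<^bsup>\<otimes>n\<^esup>\<close>, the space \<open>A \<otimes> W\<close> embeds into \<open>A \<otimes> V\<^bsup>\<otimes>n\<^esup>\<close> as the set of finite sums of
  such \<open>a \<otimes> t\<close> with \<open>t \<in> W\<close>.
\<close>

definition quotient_tensor :: "('k::field \<Rightarrow> 'v::ab_group_add \<Rightarrow> 'v) \<Rightarrow> 'v set \<Rightarrow>
    ('v, 'k) tensor set \<Rightarrow> ('v, 'k) tensor set \<Rightarrow> ('v list \<Rightarrow> ('v, 'k) tensor set) set" where
  "quotient_tensor s B R W =
    {F. \<exists>(m::nat) a t. (\<forall>i<m. a i \<in> carrier (quotient_algebra s B R) \<and> t i \<in> W) \<and>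
      F = (\<lambda>w. \<Oplus>\<^bsub>quotient_algebra s B R\<^esub> i\<in>{..<m}. quotient_scale s B R (t i w) (a i))}"

text \<open>
  \<open>\<delta>\<close> rewrites \<open>\<Sum>w. F w \<otimes> w\<close>, with \<open>w = b u\<close> for a letter \<open>b\<close>, as
  \<open>\<Sum>b u. F (b u) \<otimes> b \<otimes> u\<close>, and then multiplies \<open>F (b u)\<close> by \<open>b\<close> from the right.
\<close>

definition koszul_diff :: "('k::field \<Rightarrow> 'v::ab_group_add \<Rightarrow> 'v) \<Rightarrow> 'v set \<Rightarrow>
    ('v, 'k) tensor set \<Rightarrow> ('v list \<Rightarrow> ('v, 'k) tensor set) \<Rightarrow> 'v list \<Rightarrow> ('v, 'k) tensor set" where
  "koszul_diff s B R F = (\<lambda>u. \<Oplus>\<^bsub>quotient_algebra s B R\<^esub> b\<in>B.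
    F (b # u) \<otimes>\<^bsub>quotient_algebra s B R\<^esub> quotient_class s B R (vec s B b))"

text \<open>The augmentation \<open>A \<rightarrow> k\<close> is induced by taking the degree 0 coefficient of a tensor,
  which is constant on the classes modulo \<open>(R)\<close> if \<open>R \<subseteq> V\<^bsup>\<otimes>N\<^esup>\<close> with \<open>N \<ge> 1\<close>.\<close>

definition augmentation :: "('v, 'k::field) tensor set \<Rightarrow> 'k" where
  "augmentation a = the_elem ((\<lambda>t. t []) ` a)"

text \<open>The \<open>j\<close>-th term of the complex is \<open>A \<otimes> J\<^sub>d\<close> with \<open>d = koszul_degree N j\<close>, that is
  \<open>d = 0, 1, N, N + 1, 2 N, \<dots>\<close>.\<close>

definition koszul_degree :: "nat \<Rightarrow> nat \<Rightarrow> nat" where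
  "koszul_degree N j = (j div 2) * N + j mod 2"

definition koszul_term :: "('k::field \<Rightarrow> 'v::ab_group_add \<Rightarrow> 'v) \<Rightarrow> 'v set \<Rightarrow> nat \<Rightarrow>
    ('v, 'k) tensor set \<Rightarrow> nat \<Rightarrow> ('v list \<Rightarrow> ('v, 'k) tensor set) set" where
  "koszul_term s B N R j = quotient_tensor s B R (J s B N R (koszul_degree N j))"

text \<open>The map from term \<open>j + 1\<close> to term \<open>j\<close>: \<open>\<delta>\<close> for even \<open>j\<close>, \<open>\<delta>\<^bsup>N-1\<^esup>\<close> for odd \<open>j\<close>.\<close>

definition koszul_map :: "('k::field \<Rightarrow> 'v::ab_group_add \<Rightarrow> 'v) \<Rightarrow> 'v set \<Rightarrow> nat \<Rightarrow>
    ('v, 'k) tensor set \<Rightarrow> nat \<Rightarrow>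
    ('v list \<Rightarrow> ('v, 'k) tensor set) \<Rightarrow> 'v list \<Rightarrow> ('v, 'k) tensor set" where
  "koszul_map s B N R j = koszul_diff s B R ^^ (if even j then 1 else N - 1)"

text \<open>Kernel equals image at every term. At \<open>j = 0\<close>, where \<open>A \<otimes> J\<^sub>0 = A \<otimes> k\<close> is identified
  with \<open>A\<close> through \<open>F \<mapsto> F []\<close>, the outgoing map is the augmentation.\<close>

definition N_koszul :: "('k::field \<Rightarrow> 'v::ab_group_add \<Rightarrow> 'v) \<Rightarrow> 'v set \<Rightarrow> nat \<Rightarrow>
    ('v, 'k) tensor set \<Rightarrow> bool" where
  "N_koszul s B N R \<longleftrightarrow>
    {F \<in> koszul_term s B N R 0. augmentation (F []) = 0} =
      koszul_map s B N R 0 ` koszul_term s B N R 1 \<and>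
    (\<forall>j. {F \<in> koszul_term s B N R (Suc j).
          koszul_map s B N R j F = (\<lambda>w. \<zero>\<^bsub>quotient_algebra s B R\<^esub>)} =
      koszul_map s B N R (Suc j) ` koszul_term s B N R (Suc (Suc j)))"

end

theory Submission
  imports Defs
begin

text \<open>
  All arguments take place in a single \<open>V\<^bsup>\<otimes>D\<^esup>\<close>, with the subspaces
  \<open>X\<^sub>i = V\<^bsup>\<otimes>i-1\<^esup> \<otimes> R \<otimes> V\<^bsup>\<otimes>D-i-1\<^esup>\<close>. A family of subspaces is called distributive if
  some basis of the ambient space is adapted to it, that is, if every member is spanned by a part
  of that basis. Then all members of the lattice generated by the family are spanned by parts
  of the basis, and intersections and sums of them may be computed as intersections and unions of
  subsets of the basis.

  That a quadratic Koszul algebra is distributive is Backelin's theorem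
  (\<open>koszul_imp_distributive_family\<close>), proved by induction on \<open>D\<close>. Without \<open>X\<^sub>k\<close> the
  family splits into one that lives on the first \<open>k\<close> tensor factors and one that lives on
  the last \<open>D - k\<close>; products of adapted bases of these are adapted again, so all proper
  subfamilies of the \<open>X\<^sub>i\<close> are distributive. For a family with this property, distributivity
  amounts to the conditions
  \<open>X\<^sub>T \<inter> (\<Sum>i\<notin>T. X\<^sub>i) = (\<Sum>i\<notin>T. X\<^sub>T \<inter> X\<^sub>i)\<close> for all sets \<open>T\<close> of indices, where
  \<open>X\<^sub>T = (\<Inter>i\<in>T. X\<^sub>i)\<close> (\<open>distributive_familyI\<close>). The crucial point is that one
  index of \<open>T\<close> may be exchanged for another (\<open>swap_index\<close>), so that a single \<open>T\<close> of each
  cardinality is enough. For \<open>T = {m+1, \<dots>, D-1}\<close> the condition follows from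
  exactness of the Koszul complex at \<open>A\<^sub>m \<otimes> J\<^bsub>D-m\<^esub>\<close>.

  The last statement needs the Koszul complex without quotients. Elements of
  \<open>A \<otimes> J\<^sub>n\<close> lift to tensors \<open>G \<in> TV \<otimes> J\<^sub>n \<subseteq> TV\<close>, and on these lifts the
  differential is the identity: it only moves the border between the part of a word that is read modulo
  the ideal and the part that is not. Exactness therefore becomes, degree by degree, an inclusion
  between lattice expressions in the subspaces \<open>V\<^bsup>\<otimes>i-1\<^esup> \<otimes> R \<otimes> V\<^bsup>\<otimes>D-N-i+1\<^esup>\<close>
  (\<open>N_koszul_iff\<close>). This holds for every degree \<open>N\<close> of the relations and is used
  from left to right for \<open>R\<close> and from right to left for \<open>R'\<close>.

  The subspaces that \<open>R'\<close> generates in \<open>V\<^bsup>\<otimes>D\<^esup>\<close> lie in the lattice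
  generated by the \<open>X\<^sub>i\<close>, so \<open>TV/(R')\<close> is distributive. If \<open>R'\<close> is the full
  intersection, its \<open>i\<close>-th copy in \<open>V\<^bsup>\<otimes>D\<^esup>\<close> is \<open>X\<^sub>i \<inter> \<dots> \<inter> X\<^bsub>i+N-2\<^esub>\<close>. The extra
  condition then says that an interval of indices is covered by two others, and exactness of the
  \<open>N\<close>-Koszul complex follows from one application of the distributive law in the lattice of the
  \<open>X\<^sub>i\<close>.
\<close>

section \<open>Coordinate subspaces of an independent set\<close>

context vector_space
begin

definition coordinate_subspaces :: "'b set \<Rightarrow> 'b set set" where
  "coordinate_subspaces \<beta> = {span \<gamma> | \<gamma>. \<gamma> \<subseteq> \<beta>}"

lemma coordinate_subspacesI: "\<gamma> \<subseteq> \<beta> \<Longrightarrow> span \<gamma> \<in> coordinate_subspaces \<beta>"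
  unfolding coordinate_subspaces_def by blast

text \<open>
  Coordinates with respect to \<open>\<beta>\<close> are unique, so those of a vector in both spans are
  supported in \<open>\<gamma>\<close> and in \<open>\<delta>\<close>. This is what turns subspace identities into identities
  between subsets of \<open>\<beta>\<close>.
\<close>

lemma span_Int_independent:
  assumes "independent \<beta>" "\<gamma> \<subseteq> \<beta>" "\<delta> \<subseteq> \<beta>"
  shows "span \<gamma> \<inter> span \<delta> = span (\<gamma> \<inter> \<delta>)"
proof
  show "span (\<gamma> \<inter> \<delta>) \<subseteq> span \<gamma> \<inter> span \<delta>"
    by (simp add: span_mono)
  show "span \<gamma> \<inter> span \<delta> \<subseteq> span (\<gamma> \<inter> \<delta>)"
  proof
    fix x assume x: "x \<in> span \<gamma> \<inter> span \<delta>"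
    have *: "representation \<beta> x = representation \<gamma> x" "representation \<beta> x = representation \<delta> x"
      using x assms by (auto intro!: representation_extend)
    have "x = (\<Sum>b | representation \<beta> x b \<noteq> 0. representation \<beta> x b *s b)"
      using sum_nonzero_representation_eq[OF assms(1)] x span_mono[OF assms(2)] by auto
    also have "\<dots> \<in> span (\<gamma> \<inter> \<delta>)"
    proof (rule span_sum, rule span_scale, rule span_base)
      fix b assume "b \<in> {b. representation \<beta> x b \<noteq> 0}"
      then have "representation \<gamma> x b \<noteq> 0" "representation \<delta> x b \<noteq> 0"
        using * by auto
      then show "b \<in> \<gamma> \<inter> \<delta>"
        using representation_ne_zero by blast
    qed
    finally show "x \<in> span (\<gamma> \<inter> \<delta>)" .
  qed
qed

lemma set_plus_span: "span X + span Y = span (X \<union> Y)"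
  unfolding span_Un set_plus_def by auto

lemma span_UN_span: "span (\<Union>i\<in>I. span (f i)) = span (\<Union>i\<in>I. f i)"
proof -
  have "span (f i) \<subseteq> span (\<Union>i\<in>I. f i)" if "i \<in> I" for i
    by (rule span_mono) (use that in blast)
  then have "(\<Union>i\<in>I. span (f i)) \<subseteq> span (\<Union>i\<in>I. f i)"
    by blast
  moreover have "span (\<Union>i\<in>I. f i) \<subseteq> span (\<Union>i\<in>I. span (f i))"
    by (intro span_mono UN_mono order_refl span_superset)
  ultimately show ?thesis
    by (meson span_minimal subspace_span subset_antisym)
qed

lemma subspace_coordinate: "X \<in> coordinate_subspaces \<beta> \<Longrightarrow> subspace X"
  unfolding coordinate_subspaces_def by auto

lemma coordinate_Int:
  assumes "independent \<beta>" "X \<in> coordinate_subspaces \<beta>" "Y \<in> coordinate_subspaces \<beta>"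
  shows "X \<inter> Y \<in> coordinate_subspaces \<beta>"
proof -
  obtain \<gamma> \<delta> where "X = span \<gamma>" "\<gamma> \<subseteq> \<beta>" "Y = span \<delta>" "\<delta> \<subseteq> \<beta>"
    using assms(2,3) by (auto simp: coordinate_subspaces_def)
  then show ?thesis
    using span_Int_independent[OF assms(1), of \<gamma> \<delta>] by (simp add: coordinate_subspacesI le_infI1)
qed

lemma coordinate_span_UN:
  assumes "\<And>i. i \<in> I \<Longrightarrow> X i \<in> coordinate_subspaces \<beta>"
  shows "span (\<Union>i\<in>I. X i) \<in> coordinate_subspaces \<beta>"
proof -
  have "\<forall>i\<in>I. \<exists>\<gamma>. X i = span \<gamma> \<and> \<gamma> \<subseteq> \<beta>"
    using assms by (auto simp: coordinate_subspaces_def)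
  then obtain \<gamma> where \<gamma>: "\<And>i. i \<in> I \<Longrightarrow> X i = span (\<gamma> i) \<and> \<gamma> i \<subseteq> \<beta>"
    by metis
  then have "span (\<Union>i\<in>I. X i) = span (\<Union>i\<in>I. \<gamma> i)"
    using span_UN_span[of \<gamma> I] by simp
  then show ?thesis
    using \<gamma> by (simp add: coordinate_subspacesI UN_subset_iff)
qed

lemma coordinate_plus:
  assumes "X \<in> coordinate_subspaces \<beta>" "Y \<in> coordinate_subspaces \<beta>"
  shows "X + Y \<in> coordinate_subspaces \<beta>"
proof -
  obtain \<gamma> \<delta> where "X = span \<gamma>" "\<gamma> \<subseteq> \<beta>" "Y = span \<delta>" "\<delta> \<subseteq> \<beta>"
    using assms by (auto simp: coordinate_subspaces_def)
  then show ?thesis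
    by (simp add: set_plus_span coordinate_subspacesI)
qed

lemma coordinate_INT:
  assumes "independent \<beta>" "span \<beta> = W" "finite I"
    "\<And>i. i \<in> I \<Longrightarrow> X i \<in> coordinate_subspaces \<beta>"
  shows "W \<inter> (\<Inter>i\<in>I. X i) \<in> coordinate_subspaces \<beta>"
  using assms(3,4)
proof (induction I rule: finite_induct)
  case empty
  then show ?case
    using assms(2) coordinate_subspacesI[of \<beta> \<beta>] by simp
next
  case (insert i I)
  have "W \<inter> (\<Inter>i\<in>insert i I. X i) = X i \<inter> (W \<inter> (\<Inter>i\<in>I. X i))"
    by auto
  then show ?case
    using insert coordinate_Int[OF assms(1)] by simp
qed

text \<open>
  For subsets of \<open>\<beta>\<close> this is the distributivity of intersection over union.
\<close>

lemma coordinate_distrib: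
  assumes "independent \<beta>" "A \<in> coordinate_subspaces \<beta>"
    "\<And>i. i \<in> I \<Longrightarrow> X i \<in> coordinate_subspaces \<beta>"
  shows "A \<inter> span (\<Union>i\<in>I. X i) = span (\<Union>i\<in>I. A \<inter> X i)"
proof -
  obtain \<alpha> where \<alpha>: "A = span \<alpha>" "\<alpha> \<subseteq> \<beta>"
    using assms(2) by (auto simp: coordinate_subspaces_def)
  have "\<forall>i\<in>I. \<exists>\<gamma>. X i = span \<gamma> \<and> \<gamma> \<subseteq> \<beta>"
    using assms(3) by (auto simp: coordinate_subspaces_def)
  then obtain \<gamma> where \<gamma>: "\<And>i. i \<in> I \<Longrightarrow> X i = span (\<gamma> i) \<and> \<gamma> i \<subseteq> \<beta>"
    by metis
  have "A \<inter> span (\<Union>i\<in>I. X i) = span \<alpha> \<inter> span (\<Union>i\<in>I. \<gamma> i)"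
    using \<gamma> \<alpha> span_UN_span[of \<gamma> I] by simp
  also have "\<dots> = span (\<Union>i\<in>I. \<alpha> \<inter> \<gamma> i)"
    using span_Int_independent[OF assms(1) \<alpha>(2), of "\<Union>i\<in>I. \<gamma> i"] \<gamma> by (simp add: UN_subset_iff)
  also have "\<dots> = span (\<Union>i\<in>I. span (\<alpha> \<inter> \<gamma> i))"
    by (simp add: span_UN_span)
  also have "\<dots> = span (\<Union>i\<in>I. A \<inter> X i)"
  proof -
    have "span (\<alpha> \<inter> \<gamma> i) = A \<inter> X i" if "i \<in> I" for i
      using span_Int_independent[OF assms(1) \<alpha>(2), of "\<gamma> i"] \<gamma>[OF that] \<alpha>(1) by simp
    then show ?thesis by simp
  qed
  finally show ?thesis .
qed

lemma plus_eq_span: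
  assumes "subspace X" "subspace Y"
  shows "X + Y = span (X \<union> Y)"
  by (metis assms set_plus_span span_eq_iff)

lemma coordinate_distrib_plus:
  assumes "independent \<beta>" "A \<in> coordinate_subspaces \<beta>"
    "X \<in> coordinate_subspaces \<beta>" "Y \<in> coordinate_subspaces \<beta>"
  shows "A \<inter> (X + Y) = A \<inter> X + A \<inter> Y"
proof -
  have "A \<inter> span (\<Union>i\<in>{X,Y}. i) = span (\<Union>i\<in>{X,Y}. A \<inter> i)"
    by (rule coordinate_distrib[OF assms(1,2)]) (use assms in auto)
  moreover have "A \<inter> X + A \<inter> Y = span ((A \<inter> X) \<union> (A \<inter> Y))"
    using assms by (intro plus_eq_span subspace_inter) (auto simp: subspace_coordinate)
  ultimately show ?thesis
    using assms by (simp add: plus_eq_span subspace_coordinate)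
qed

lemma lattice_gen_coordinate:
  assumes "independent \<beta>" "G \<subseteq> coordinate_subspaces \<beta>"
  shows "lattice_gen G \<subseteq> coordinate_subspaces \<beta>"
proof
  fix Y assume "Y \<in> lattice_gen G"
  then show "Y \<in> coordinate_subspaces \<beta>"
    by induction (use assms in \<open>auto intro: coordinate_Int coordinate_plus\<close>)
qed

lemma distributive_lattice_coordinate:
  assumes "independent \<beta>" "L \<subseteq> coordinate_subspaces \<beta>"
  shows "distributive_lattice L"
  unfolding distributive_lattice_def
  using coordinate_distrib_plus[OF assms(1)] assms(2) by blast

section \<open>A criterion for distributivity\<close>

text \<open>
  For finitely many subspaces this is equivalent to distributivity of the lattice that they
  generate. The formulation through an adapted basis is the one that is stable under tensor
  products.
\<close>

definition distributive_family :: "'b set \<Rightarrow> 'i set \<Rightarrow> ('i \<Rightarrow> 'b set) \<Rightarrow> bool" where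
  "distributive_family W S X \<longleftrightarrow>
    (\<exists>\<beta>. independent \<beta> \<and> span \<beta> = W \<and> (\<forall>i\<in>S. X i \<in> coordinate_subspaces \<beta>))"

text \<open>
  The ambient space \<open>W\<close> is a parameter so that the meet of the empty family is \<open>W\<close>.
\<close>

definition fmeet :: "'b set \<Rightarrow> ('i \<Rightarrow> 'b set) \<Rightarrow> 'i set \<Rightarrow> 'b set" where
  "fmeet W X T = W \<inter> (\<Inter>i\<in>T. X i)"

definition fjoin :: "('i \<Rightarrow> 'b set) \<Rightarrow> 'i set \<Rightarrow> 'b set" where
  "fjoin X T = span (\<Union>i\<in>T. X i)"

lemma subspace_fmeet:
  "\<lbrakk>subspace W; \<And>i. i \<in> T \<Longrightarrow> subspace (X i)\<rbrakk> \<Longrightarrow> subspace (fmeet W X T)"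
  unfolding fmeet_def by (intro subspace_inter subspace_Int)

lemma subspace_fjoin: "subspace (fjoin X T)"
  unfolding fjoin_def by simp

lemma fjoin_mono: "T \<subseteq> T' \<Longrightarrow> fjoin X T \<subseteq> fjoin X T'"
  unfolding fjoin_def by (intro span_mono) blast

lemma fjoin_insert: "subspace (X i) \<Longrightarrow> fjoin X (insert i T) = X i + fjoin X T"
proof -
  assume "subspace (X i)"
  then have "span (X i) = X i" by simp
  then show ?thesis
    unfolding fjoin_def using set_plus_span[of "X i" "\<Union>i\<in>T. X i"] by (metis UN_insert)
qed

lemma distributive_family_meet_join:
  assumes "distributive_family W S X" "finite S" "T \<subseteq> S" "P \<subseteq> S"
  shows "fmeet W X T \<inter> fjoin X P = fjoin (\<lambda>i. fmeet W X (insert i T)) P"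
proof -
  obtain \<beta> where \<beta>: "independent \<beta>" "span \<beta> = W" "\<forall>i\<in>S. X i \<in> coordinate_subspaces \<beta>"
    using assms(1) unfolding distributive_family_def by blast
  have "finite T" using assms finite_subset by blast
  have "fmeet W X T \<in> coordinate_subspaces \<beta>"
    unfolding fmeet_def using \<beta> assms \<open>finite T\<close> by (intro coordinate_INT) auto
  then have "fmeet W X T \<inter> fjoin X P = fjoin (\<lambda>i. fmeet W X T \<inter> X i) P"
    unfolding fjoin_def using \<beta> assms by (intro coordinate_distrib) auto
  also have "(\<lambda>i. fmeet W X T \<inter> X i) = (\<lambda>i. fmeet W X (insert i T))"
    unfolding fmeet_def by auto
  finally show ?thesis .
qed

lemma distributive_family_triple:
  assumes "distributive_family W S X" "finite S" "T \<subseteq> S" "P \<subseteq> S" "a \<in> S"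
  shows "X a \<inter> (fmeet W X T + fjoin X P) = X a \<inter> fmeet W X T + X a \<inter> fjoin X P"
proof -
  obtain \<beta> where \<beta>: "independent \<beta>" "span \<beta> = W" "\<forall>i\<in>S. X i \<in> coordinate_subspaces \<beta>"
    using assms(1) unfolding distributive_family_def by blast
  have "finite T" using assms finite_subset by blast
  have "fmeet W X T \<in> coordinate_subspaces \<beta>"
    unfolding fmeet_def using \<beta> assms \<open>finite T\<close> by (intro coordinate_INT) auto
  moreover have "fjoin X P \<in> coordinate_subspaces \<beta>"
    unfolding fjoin_def using \<beta> assms by (intro coordinate_span_UN) auto
  ultimately show ?thesis
    using \<beta> assms by (intro coordinate_distrib_plus) auto
qed

lemma independent_Un:
  assumes "independent A" "independent B" "span A \<inter> span B \<subseteq> {0}"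
  shows "independent (A \<union> B)"
  unfolding independent_explicit_module
proof (intro allI impI)
  fix t u v
  assume t: "finite t" "t \<subseteq> A \<union> B" and z: "(\<Sum>v\<in>t. u v *s v) = 0" and v: "v \<in> t"
  let ?a = "\<Sum>v\<in>t \<inter> A. u v *s v" and ?b = "\<Sum>v\<in>t - A. u v *s v"
  have ab: "?a + ?b = 0"
    using z t(1) by (metis sum.Int_Diff)
  have a: "?a \<in> span A"
    by (intro span_sum span_scale span_base) auto
  have b: "?b \<in> span B"
    using t by (intro span_sum span_scale span_base) auto
  have "?a = - ?b"
    using ab by (simp add: add_eq_0_iff2)
  then have "?a \<in> span B"
    using b span_neg by metis
  then have "?a = 0"
    using a assms(3) by auto
  moreover from this have "?b = 0"
    using ab by simp
  ultimately show "u v = 0"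
    using v t independentD[OF assms(1), of "t \<inter> A" u v] independentD[OF assms(2), of "t - A" u v]
    by (cases "v \<in> A") auto
qed

lemma complement_basis_exists:
  assumes "subspace N" "N \<subseteq> M"
  shows "\<exists>\<beta>. independent \<beta> \<and> \<beta> \<subseteq> M \<and> span \<beta> \<inter> N \<subseteq> {0} \<and> M \<subseteq> span (\<beta> \<union> N)"
proof -
  obtain A where A: "A \<subseteq> N" "independent A" "N \<subseteq> span A"
    using basis_exists[of N] by metis
  obtain B where B: "A \<subseteq> B" "B \<subseteq> M" "independent B" "M \<subseteq> span B"
    using maximal_independent_subset_extend[of A M] A assms by (metis order_trans)
  have "span (B - A) \<inter> span A = span ((B - A) \<inter> A)"
    by (rule span_Int_independent[OF B(3)]) (use B in auto)
  moreover have "(B - A) \<inter> A = {}"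
    by auto
  ultimately have "span (B - A) \<inter> N \<subseteq> {0}"
    using A(3) by auto
  moreover have "span B \<subseteq> span ((B - A) \<union> N)"
    using A by (intro span_mono) auto
  ultimately show ?thesis
    using B independent_mono[OF B(3), of "B - A"] by (intro exI[of _ "B - A"]) auto
qed

lemma fmeet_antimono: "T \<subseteq> T' \<Longrightarrow> fmeet W X T' \<subseteq> fmeet W X T"
  unfolding fmeet_def by auto

text \<open>
  For every \<open>T\<close> choose a basis \<open>b T\<close> of a complement of the sum of the smaller meets in
  \<open>fmeet W X T\<close>. By downward induction on \<open>T\<close>, every meet is spanned by the \<open>b T'\<close> with
  \<open>T \<subseteq> T'\<close>, so the union of all \<open>b T\<close> is adapted as soon as it is independent. This is
  what the hypothesis gives: if the sets \<open>T\<close> are added in order of decreasing cardinality, then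
  all earlier \<open>b T'\<close> lie in the join of the \<open>X i\<close> with \<open>i \<notin> T\<close>, and this join meets
  \<open>fmeet W X T\<close> only in the sum of the smaller meets.
\<close>

lemma distributive_familyI:
  fixes X :: "'i \<Rightarrow> 'b set"
  assumes fin: "finite S" and W: "subspace W" and X: "\<And>i. i \<in> S \<Longrightarrow> subspace (X i)"
    and XW: "\<And>i. i \<in> S \<Longrightarrow> X i \<subseteq> W"
    and D: "\<And>T. T \<subseteq> S \<Longrightarrow>
      fmeet W X T \<inter> fjoin X (S - T) \<subseteq> fjoin (\<lambda>i. fmeet W X (insert i T)) (S - T)"
  shows "distributive_family W S X"
proof -
  define N where "N T = fjoin (\<lambda>i. fmeet W X (insert i T)) (S - T)" for T
  have sub_meet: "subspace (fmeet W X T)" if "T \<subseteq> S" for T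
    using that W X by (intro subspace_fmeet) auto
  have "N T \<subseteq> fmeet W X T" if "T \<subseteq> S" for T
    unfolding N_def fjoin_def using sub_meet[OF that]
    by (intro span_minimal) (auto simp: fmeet_def)
  then have "\<forall>T\<in>Pow S. \<exists>\<beta>. independent \<beta> \<and> \<beta> \<subseteq> fmeet W X T \<and> span \<beta> \<inter> N T \<subseteq> {0} \<and>
      fmeet W X T \<subseteq> span (\<beta> \<union> N T)"
    unfolding N_def by (intro ballI complement_basis_exists subspace_fjoin) auto
  then obtain b where b: "\<And>T. T \<in> Pow S \<Longrightarrow> independent (b T) \<and> b T \<subseteq> fmeet W X T \<and>
      span (b T) \<inter> N T \<subseteq> {0} \<and> fmeet W X T \<subseteq> span (b T \<union> N T)"
    using bchoice[of "Pow S"] by metis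
  define up where "up T = {T'. T \<subseteq> T' \<and> T' \<subseteq> S}" for T
  have meet_span: "fmeet W X T = span (\<Union>T'\<in>up T. b T')" if "T \<subseteq> S" for T
    using that
  proof (induction "card (S - T)" arbitrary: T rule: less_induct)
    case less
    show ?case
    proof
      show "span (\<Union>T'\<in>up T. b T') \<subseteq> fmeet W X T"
      proof (rule span_minimal[OF _ sub_meet[OF less.prems]], rule UN_least)
        fix T' assume "T' \<in> up T"
        then show "b T' \<subseteq> fmeet W X T"
          using b[of T'] fmeet_antimono[of T T' W X] unfolding up_def by blast
      qed
      have "N T \<subseteq> span (\<Union>T'\<in>up T. b T')"
        unfolding N_def fjoin_def
      proof (rule span_minimal[OF _ subspace_span], rule UN_least)
        fix i assume i: "i \<in> S - T"
        then have "card (S - insert i T) < card (S - T)"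
          using fin by (intro psubset_card_mono) auto
        then have "fmeet W X (insert i T) = span (\<Union>T'\<in>up (insert i T). b T')"
          using i less.prems by (intro less.hyps) auto
        also have "\<dots> \<subseteq> span (\<Union>T'\<in>up T. b T')"
          unfolding up_def by (intro span_mono) auto
        finally show "fmeet W X (insert i T) \<subseteq> span (\<Union>T'\<in>up T. b T')" .
      qed
      moreover have "b T \<subseteq> span (\<Union>T'\<in>up T. b T')"
        using less.prems by (intro order_trans[OF _ span_superset]) (auto simp: up_def)
      ultimately have "span (b T \<union> N T) \<subseteq> span (\<Union>T'\<in>up T. b T')"
        by (intro span_minimal) auto
      then show "fmeet W X T \<subseteq> span (\<Union>T'\<in>up T. b T')"
        using b[of T] less.prems by auto
    qed
  qed
  have indep: "independent (\<Union>T\<in>\<T>. b T)" if "\<T> \<subseteq> Pow S" for \<T>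
  proof -
    have "finite \<T>"
      using that fin by (simp add: finite_subset)
    then show ?thesis
      using that
    proof (induction \<T> rule: finite_ranking_induct[where f = "\<lambda>T. card (S - T)"])
      case empty
      then show ?case by (simp add: independent_empty)
    next
      case (insert T \<T>)
      show ?case
      proof (cases "T \<in> \<T>")
        case True
        then show ?thesis using insert by (simp add: insert_absorb)
      next
        case False
        have T: "T \<subseteq> S" using insert.prems by auto
        have "span (\<Union>T\<in>\<T>. b T) \<subseteq> fjoin X (S - T)"
        proof (rule span_minimal[OF _ subspace_fjoin], rule UN_least)
          fix T' assume T': "T' \<in> \<T>"
          have "\<not> T' \<subseteq> T"
          proof
            assume "T' \<subseteq> T"
            moreover have "T' \<noteq> T"
              using False T' by auto
            ultimately have "S - T \<subset> S - T'"
              using T by blast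
            then have "card (S - T) < card (S - T')"
              using fin by (intro psubset_card_mono) auto
            then show False
              using insert.hyps(2)[OF T'] by simp
          qed
          then obtain i where i: "i \<in> T'" "i \<notin> T"
            by blast
          have "T' \<subseteq> S"
            using T' insert.prems by auto
          then have "b T' \<subseteq> X i" "i \<in> S - T"
            using b[of T'] i by (auto simp: fmeet_def)
          then show "b T' \<subseteq> fjoin X (S - T)"
            unfolding fjoin_def by (intro order_trans[OF _ span_superset]) auto
        qed
        moreover have "span (b T) \<subseteq> fmeet W X T"
          using b[of T] T sub_meet by (intro span_minimal) auto
        ultimately have "span (b T) \<inter> span (\<Union>T\<in>\<T>. b T) \<subseteq> span (b T) \<inter> N T"
          using D[OF T] unfolding N_def by blast
        then have "span (b T) \<inter> span (\<Union>T\<in>\<T>. b T) \<subseteq> {0}"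
          using b[of T] T by blast
        then show ?thesis
          using independent_Un[of "b T" "\<Union>T\<in>\<T>. b T"] b[of T] T insert by simp
      qed
    qed
  qed
  define \<beta> where "\<beta> = (\<Union>T\<in>Pow S. b T)"
  have "span \<beta> = fmeet W X {}"
    using meet_span[of "{}"] unfolding \<beta>_def up_def by (simp add: Pow_def)
  moreover have "X i \<in> coordinate_subspaces \<beta>" if "i \<in> S" for i
  proof -
    have "X i = fmeet W X {i}"
      using XW[OF that] by (auto simp: fmeet_def)
    also have "\<dots> = span (\<Union>T'\<in>up {i}. b T')"
      using that by (intro meet_span) auto
    finally show ?thesis
      unfolding \<beta>_def by (auto simp: up_def intro!: coordinate_subspacesI)
  qed
  ultimately show ?thesis
    unfolding distributive_family_def using indep[of "Pow S"] unfolding \<beta>_def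
    by (intro exI[of _ \<beta>]) (auto simp: \<beta>_def fmeet_def)
qed

text \<open>
  With \<open>U\<close> the meet over \<open>Q\<close> and \<open>Y\<close> the join over the indices outside \<open>Q \<union> {a, b}\<close>,
  and as the proper subfamilies are distributive, the claim for \<open>b\<close> reads
  \<open>X b \<inter> U \<inter> (X a + Y) = X b \<inter> U \<inter> Y + X a \<inter> X b \<inter> U\<close>. For
  \<open>x = \<alpha> + y\<close> on the left-hand side, distributivity of the family without \<open>b\<close> allows to choose
  \<open>\<alpha>\<close> in \<open>X a \<inter> U\<close>. Then \<open>\<alpha>\<close> is in \<open>X b + Y\<close> as well, and the assumption for \<open>a\<close>
  splits \<open>\<alpha>\<close> into a part in \<open>X a \<inter> X b \<inter> U\<close> and a part in \<open>Y\<close>.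
\<close>

lemma swap_index:
  assumes fin: "finite S" and W: "subspace W" and X: "\<And>i. i \<in> S \<Longrightarrow> subspace (X i)"
    and proper: "\<And>k. k \<in> S \<Longrightarrow> distributive_family W (S - {k}) X"
    and Q: "insert a (insert b Q) \<subseteq> S" "a \<notin> Q" "b \<notin> Q" "a \<noteq> b"
    and Da: "fmeet W X (insert a Q) \<inter> fjoin X (S - insert a Q) \<subseteq>
      fjoin (\<lambda>i. fmeet W X (insert i (insert a Q))) (S - insert a Q)"
  shows "fmeet W X (insert b Q) \<inter> fjoin X (S - insert b Q) \<subseteq>
      fjoin (\<lambda>i. fmeet W X (insert i (insert b Q))) (S - insert b Q)"
proof
  define P where "P = S - insert a (insert b Q)"
  define U where "U = fmeet W X Q"
  define Y where "Y = fjoin X P"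
  define E where "E c = fjoin (\<lambda>i. fmeet W X (insert i (insert c Q))) P" for c
  have subU: "subspace U"
    unfolding U_def using W X Q by (intro subspace_fmeet) auto
  have meet_ins: "fmeet W X (insert c Q) = X c \<inter> U" for c
    unfolding U_def fmeet_def by auto
  have E: "X c \<inter> U \<inter> Y = E c" if "c \<in> {a, b}" for c
  proof -
    define d where "d = (if c = a then b else a)"
    have "d \<in> S" "insert c Q \<subseteq> S - {d}" "P \<subseteq> S - {d}"
      using Q that unfolding d_def P_def by auto
    then show ?thesis
      using distributive_family_meet_join[OF proper[of d] _ , of "insert c Q" P] fin
      unfolding meet_ins Y_def E_def by simp
  qed
  have Sa: "S - insert a Q = insert b P" and Sb: "S - insert b Q = insert a P"
    unfolding P_def using Q by auto
  have sub_ab: "subspace (fmeet W X (insert a (insert b Q)))"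
    using W X Q by (intro subspace_fmeet) auto
  have joinE: "fjoin (\<lambda>i. fmeet W X (insert i (insert c Q))) (insert d P) =
      fmeet W X (insert a (insert b Q)) + E c" if "{c, d} = {a, b}" for c d
  proof -
    have "insert d (insert c Q) = insert a (insert b Q)"
      using that by auto
    then show ?thesis
      using fjoin_insert[of "\<lambda>i. fmeet W X (insert i (insert c Q))" d P] sub_ab
      unfolding E_def by simp
  qed
  have joinX: "fjoin X (insert d P) = X d + Y" if "d \<in> {a, b}" for d
    unfolding Y_def using that X Q by (intro fjoin_insert) auto
  have triple: "X a \<inter> (U + Y) \<subseteq> X a \<inter> U + X a \<inter> Y"
    using distributive_family_triple[OF proper[of b], of Q P a] fin Q
    unfolding U_def Y_def P_def by auto
  fix x assume "x \<in> fmeet W X (insert b Q) \<inter> fjoin X (S - insert b Q)"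
  then have x: "x \<in> X b" "x \<in> U" "x \<in> X a + Y"
    unfolding meet_ins Sb using joinX[of a] by auto
  obtain \<alpha> y where \<alpha>y: "\<alpha> \<in> X a" "y \<in> Y" "x = \<alpha> + y"
    using x(3) by (rule set_plus_elim)
  have subY: "subspace Y" unfolding Y_def by (rule subspace_fjoin)
  have "\<alpha> = x + (- y)"
    using \<alpha>y by simp
  moreover have "- y \<in> Y"
    using subY \<alpha>y by (simp add: subspace_neg)
  ultimately have "\<alpha> \<in> X a \<inter> (U + Y)"
    using \<alpha>y x by blast
  then obtain \<alpha>' y' where \<alpha>': "\<alpha>' \<in> X a" "\<alpha>' \<in> U" "y' \<in> Y" "\<alpha> = \<alpha>' + y'"
    using triple by (blast elim: set_plus_elim)
  \<comment> \<open>Thus \<open>x\<close> is the sum of an element of \<open>X a \<inter> U\<close> and one of \<open>Y\<close>.\<close>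
  have "\<alpha>' = x + (- (y + y'))"
    using \<alpha>y \<alpha>' by simp
  moreover have "- (y + y') \<in> Y"
    using subY \<alpha>y \<alpha>' by (intro subspace_neg subspace_add)
  ultimately have "\<alpha>' \<in> X b + Y"
    using x by blast
  then have "\<alpha>' \<in> fmeet W X (insert a Q) \<inter> fjoin X (S - insert a Q)"
    unfolding meet_ins Sa using joinX[of b] \<alpha>' by auto
  then have "\<alpha>' \<in> fmeet W X (insert a (insert b Q)) + E a"
    using Da joinE[of a b] unfolding Sa by auto
  then obtain z e where ze: "z \<in> fmeet W X (insert a (insert b Q))" "e \<in> E a" "\<alpha>' = z + e"
    by (rule set_plus_elim)
  have z: "z \<in> X b" "z \<in> U"
    using ze(1) unfolding U_def fmeet_def by auto
  have e: "e \<in> Y"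
    using ze(2) E[of a] by auto
  have "x - z = e + y + y'"
    using \<alpha>y \<alpha>' ze by (simp add: algebra_simps)
  moreover have "e + y + y' \<in> Y"
    using subY e \<alpha>y \<alpha>' by (simp add: subspace_add)
  moreover have "x - z \<in> X b \<inter> U"
    using x z subU X[of b] Q by (auto intro!: subspace_diff)
  ultimately have "x - z \<in> E b"
    using E[of b] by auto
  then have "z + (x - z) \<in> fmeet W X (insert a (insert b Q)) + E b"
    using ze(1) by (intro set_plus_intro)
  then show "x \<in> fjoin (\<lambda>i. fmeet W X (insert i (insert b Q))) (S - insert b Q)"
    unfolding Sb using joinE[of b a] by auto
qed

text \<open>
  By exchanging one index at a time, the condition passes from one \<open>T\<close> to all sets of the
  same cardinality.
\<close>

lemma distributive_family_if_layers:
  assumes fin: "finite S" and W: "subspace W" and X: "\<And>i. i \<in> S \<Longrightarrow> subspace (X i)"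
    and XW: "\<And>i. i \<in> S \<Longrightarrow> X i \<subseteq> W"
    and proper: "\<And>k. k \<in> S \<Longrightarrow> distributive_family W (S - {k}) X"
    and layer: "\<And>p. p \<le> card S \<Longrightarrow> \<exists>T\<subseteq>S. card T = p \<and>
      fmeet W X T \<inter> fjoin X (S - T) \<subseteq> fjoin (\<lambda>i. fmeet W X (insert i T)) (S - T)"
  shows "distributive_family W S X"
proof (rule distributive_familyI[OF fin W X XW])
  define good where "good T \<longleftrightarrow>
    fmeet W X T \<inter> fjoin X (S - T) \<subseteq> fjoin (\<lambda>i. fmeet W X (insert i T)) (S - T)" for T
  have move: "good T" if "good T0" "T0 \<subseteq> S" "T \<subseteq> S" "card T = card T0" for T T0
    using that
  proof (induction "card (T - T0)" arbitrary: T0 rule: less_induct)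
    case less
    have fT: "finite T" "finite T0"
      using less.prems fin finite_subset by auto
    show ?case
    proof (cases "T \<subseteq> T0")
      case True
      then have "T = T0" using less.prems fT by (simp add: card_subset_eq)
      then show ?thesis using less.prems by simp
    next
      case False
      then obtain b where b: "b \<in> T" "b \<notin> T0" by auto
      have "\<not> T0 \<subseteq> T"
        using False less.prems(4) fT by (metis card_subset_eq order_refl)
      then obtain a where a: "a \<in> T0" "a \<notin> T" by auto
      define Q where "Q = T0 - {a}"
      have T0: "T0 = insert a Q" and aQ: "a \<notin> Q" "b \<notin> Q" "a \<noteq> b"
        unfolding Q_def using a b by auto
      have "good (insert b Q)"
        unfolding good_def
        by (rule swap_index[OF fin W X proper, of a b Q])
          (use less.prems aQ b T0 in \<open>auto simp: good_def\<close>)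
      moreover have "card (T - insert b Q) < card (T - T0)"
        using fT b a aQ unfolding T0 by (intro psubset_card_mono) auto
      moreover have "card T = card (insert b Q)"
        using less.prems(4) T0 aQ fT by simp
      ultimately show ?thesis
        using less.prems b T0 by (intro less.hyps[of "insert b Q"]) auto
    qed
  qed
  fix T assume T: "T \<subseteq> S"
  have "card T \<le> card S"
    using T fin by (rule card_mono[rotated])
  then obtain T0 where "T0 \<subseteq> S" "card T0 = card T" "good T0"
    using layer unfolding good_def by blast
  then have "good T"
    using move T by metis
  then show "fmeet W X T \<inter> fjoin X (S - T) \<subseteq> fjoin (\<lambda>i. fmeet W X (insert i T)) (S - T)"
    unfolding good_def .
qed

end

section \<open>Tensors as functions on words\<close>

interpretation T: vector_space "tscale :: 'k::field \<Rightarrow> ('v, 'k) tensor \<Rightarrow> ('v, 'k) tensor"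
  by unfold_locales (auto simp: tscale_def fun_eq_iff algebra_simps)

lemma tscale_apply: "tscale c t w = c * t w"
  by (simp add: tscale_def)

lemma sum_fun_apply: "(sum f A) x = (\<Sum>i\<in>A. f i x)"
  for f :: "'i \<Rightarrow> 'a \<Rightarrow> 'b::comm_monoid_add"
  by (induction A rule: infinite_finite_induct) simp_all

text \<open>As simplification rules, these would also fire below an abstraction whenever unification
  has \<open>\<eta>\<close>-expanded a tensor, and so destroy the vector space structure of the goal.\<close>

declare plus_fun_apply [simp del] zero_fun_apply [simp del]

lemmas tensor_apply = plus_fun_apply zero_fun_apply fun_Compl_def fun_diff_def tscale_apply
  sum_fun_apply

lemma tmult_add_left: "tmult (t + t') u = tmult t u + tmult t' u"
  unfolding tmult_def by (auto simp: tensor_apply fun_eq_iff algebra_simps sum.distrib)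

lemma tmult_add_right: "tmult t (u + u') = tmult t u + tmult t u'"
  unfolding tmult_def by (auto simp: tensor_apply fun_eq_iff algebra_simps sum.distrib)

lemma tmult_scale_left: "tmult (tscale c t) u = tscale c (tmult t u)"
  unfolding tmult_def by (auto simp: tensor_apply fun_eq_iff sum_distrib_left algebra_simps)

lemma tmult_scale_right: "tmult t (tscale c u) = tscale c (tmult t u)"
  unfolding tmult_def by (auto simp: tensor_apply fun_eq_iff sum_distrib_left algebra_simps)

lemma tmult_0_left [simp]: "tmult 0 u = 0"
  unfolding tmult_def by (auto simp: tensor_apply fun_eq_iff)

lemma tmult_0_right [simp]: "tmult u 0 = 0"
  unfolding tmult_def by (auto simp: tensor_apply fun_eq_iff)

lemma tmult_sum_left: "tmult (sum f A) u = (\<Sum>i\<in>A. tmult (f i) u)"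
  by (induction A rule: infinite_finite_induct) (auto simp: tmult_add_left)

lemma tmult_sum_right: "tmult u (sum f A) = (\<Sum>i\<in>A. tmult u (f i))"
  by (induction A rule: infinite_finite_induct) (auto simp: tmult_add_right)

lemma tprod_span:
  "tprod (tspan A) (tspan C) = tspan {tmult a c | a c. a \<in> A \<and> c \<in> C}" (is "_ = tspan ?G")
proof
  show "tspan ?G \<subseteq> tprod (tspan A) (tspan C)"
    unfolding tprod_def by (rule T.span_mono) (auto intro: T.span_base)
  have 1: "tmult a y \<in> tspan ?G" if "a \<in> A" "y \<in> tspan C" for a y
    using that(2)
  proof (induction y rule: T.span_induct_alt)
    case base
    then show ?case by (simp add: T.span_zero)
  next
    case (step c x y)
    then show ?case
      using that(1)
      by (auto simp: tmult_add_right tmult_scale_right intro!: T.span_add T.span_scale intro: T.span_base)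
  qed
  have 2: "tmult x y \<in> tspan ?G" if "x \<in> tspan A" "y \<in> tspan C" for x y
    using that(1)
  proof (induction x rule: T.span_induct_alt)
    case base
    then show ?case by (simp add: T.span_zero)
  next
    case (step c a x)
    then show ?case
      using 1[OF step(1) that(2)]
      by (auto simp: tmult_add_left tmult_scale_left intro!: T.span_add T.span_scale)
  qed
  then show "tprod (tspan A) (tspan C) \<subseteq> tspan ?G"
    unfolding tprod_def by (intro T.span_minimal T.subspace_span) auto
qed

lemma subspace_tprod: "tsubspace (tprod U W)"
  unfolding tprod_def by (rule T.subspace_span)

lemma tprod_UN_right:
  "tprod U (tspan (\<Union>j\<in>I. X j)) = tspan (\<Union>j\<in>I. tprod U (X j))" if "tsubspace U"
proof -
  have "tspan U = U" using that by simp
  then have "tprod U (tspan (\<Union>j\<in>I. X j)) = tspan {tmult a c | a c. a \<in> U \<and> c \<in> (\<Union>j\<in>I. X j)}"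
    using tprod_span[of U "\<Union>j\<in>I. X j"] by (simp only:)
  moreover have "{tmult a c | a c. a \<in> U \<and> c \<in> (\<Union>j\<in>I. X j)} =
      (\<Union>j\<in>I. {tmult a c | a c. a \<in> U \<and> c \<in> X j})"
    by auto
  ultimately show ?thesis
    by (simp only: tprod_def T.span_UN_span)
qed

lemma tprod_UN_left:
  "tprod (tspan (\<Union>j\<in>I. X j)) U = tspan (\<Union>j\<in>I. tprod (X j) U)" if "tsubspace U"
proof -
  have "tspan U = U" using that by simp
  then have "tprod (tspan (\<Union>j\<in>I. X j)) U = tspan {tmult a c | a c. a \<in> (\<Union>j\<in>I. X j) \<and> c \<in> U}"
    using tprod_span[of "\<Union>j\<in>I. X j" U] by (simp only:)
  moreover have "{tmult a c | a c. a \<in> (\<Union>j\<in>I. X j) \<and> c \<in> U} =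
      (\<Union>j\<in>I. {tmult a c | a c. a \<in> X j \<and> c \<in> U})"
    by auto
  ultimately show ?thesis
    by (simp only: tprod_def T.span_UN_span)
qed

definition word_tensor :: "'v list \<Rightarrow> ('v, 'k::field) tensor" where
  "word_tensor w = (\<lambda>x. if x = w then 1 else 0)"

text \<open>
  The tensor of degree \<open>n\<close> found in \<open>t\<close> between the words \<open>a\<close> and \<open>b\<close>. Membership in
  \<open>V\<^bsup>\<otimes>i\<^esup> \<otimes> R \<otimes> V\<^bsup>\<otimes>j\<^esup>\<close> is a condition on slices, which makes it evident how such subspaces
  intersect and how they nest.
\<close>

definition slice :: "nat \<Rightarrow> 'v list \<Rightarrow> 'v list \<Rightarrow> ('v, 'k::field) tensor \<Rightarrow> ('v, 'k) tensor" where
  "slice n a b t = (\<lambda>u. if length u = n then t (a @ u @ b) else 0)"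

lemma slice_add: "slice n a b (t + u) = slice n a b t + slice n a b u"
  by (auto simp: slice_def tensor_apply fun_eq_iff)

lemma slice_scale: "slice n a b (tscale c t) = tscale c (slice n a b t)"
  by (auto simp: slice_def tensor_apply fun_eq_iff)

lemma slice_0: "slice n a b 0 = 0"
  by (auto simp: slice_def tensor_apply fun_eq_iff)

lemma slice_slice:
  "length a' + m + length b' = n \<Longrightarrow> slice m a' b' (slice n a b t) = slice m (a @ a') (b' @ b) t"
  by (auto simp: slice_def tensor_apply fun_eq_iff)

lemma subspace_slices:
  assumes "tsubspace H" "tsubspace R"
  shows "tsubspace {t \<in> H. \<forall>a b. P a b \<longrightarrow> slice n a b t \<in> R}"
  using assms by (auto simp: tensor_apply T.subspace_def slice_add slice_scale slice_0)

locale tensor_setting = V: finite_dimensional_vector_space s B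
  for s :: "'k::field \<Rightarrow> 'v::ab_group_add \<Rightarrow> 'v" and B :: "'v set"
begin

definition words :: "nat \<Rightarrow> 'v list set" where
  "words n = {w. set w \<subseteq> B \<and> length w = n}"

text \<open>
  The space \<open>V\<^bsup>\<otimes>n\<^esup>\<close> in coordinates (\<open>Vpow_eq\<close>).
\<close>

definition homog :: "nat \<Rightarrow> ('v, 'k) tensor set" where
  "homog n = {t. \<forall>w. w \<notin> words n \<longrightarrow> t w = 0}"

lemma finite_words: "finite (words n)"
  unfolding words_def using V.finite_Basis by (rule finite_lists_length_eq)

lemma subspace_homog: "tsubspace (homog n)"
  unfolding homog_def by (auto simp: tensor_apply T.subspace_def)

lemma homogD: "t \<in> homog n \<Longrightarrow> t w \<noteq> 0 \<Longrightarrow> length w = n \<and> set w \<subseteq> B"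
  unfolding homog_def words_def by auto

lemma homogI: "(\<And>w. t w \<noteq> 0 \<Longrightarrow> length w = n \<and> set w \<subseteq> B) \<Longrightarrow> t \<in> homog n"
  unfolding homog_def words_def by auto

lemma word_tensor_homog: "w \<in> words n \<Longrightarrow> word_tensor w \<in> homog n"
  unfolding homog_def word_tensor_def by auto

lemma tmult_homog_left:
  assumes "t \<in> homog k"
  shows "tmult t u w = (if k \<le> length w then t (take k w) * u (drop k w) else 0)"
proof -
  have "t (take i w) * u (drop i w) = (if i = k then t (take k w) * u (drop k w) else 0)"
    if "i \<le> length w" for i
  proof (cases "i = k")
    case False
    then have "t (take i w) = 0"
      using homogD[OF assms, of "take i w"] that by fastforce
    then show ?thesis using False by simp
  qed simp
  then have "tmult t u w = (\<Sum>i\<le>length w. if i = k then t (take k w) * u (drop k w) else 0)"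
    unfolding tmult_def by (intro sum.cong) simp_all
  then show ?thesis by simp
qed

lemma tmult_homog_right:
  assumes "u \<in> homog k"
  shows "tmult t u w = (if k \<le> length w then t (take (length w - k) w) * u (drop (length w - k) w) else 0)"
proof -
  have "t (take i w) * u (drop i w) = (if i = length w - k then (if k \<le> length w then
      t (take (length w - k) w) * u (drop (length w - k) w) else 0) else 0)"
    if "i \<le> length w" for i
  proof (cases "u (drop i w) = 0")
    case True
    then show ?thesis by auto
  next
    case False
    then have "length w - i = k"
      using homogD[OF assms, of "drop i w"] by simp
    then have "i = length w - k" "k \<le> length w"
      using that by auto
    then show ?thesis by simp
  qed
  then have "tmult t u w = (\<Sum>i\<le>length w. if i = length w - k then (if k \<le> length w then
      t (take (length w - k) w) * u (drop (length w - k) w) else 0) else 0)"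
    unfolding tmult_def by (intro sum.cong) simp_all
  then show ?thesis by simp
qed

lemma tmult_homog:
  assumes "t \<in> homog k" "u \<in> homog l"
  shows "tmult t u \<in> homog (k + l)"
proof (rule homogI)
  fix w assume "tmult t u w \<noteq> 0"
  then have *: "k \<le> length w" "t (take k w) \<noteq> 0" "u (drop k w) \<noteq> 0"
    by (auto simp: tmult_homog_left[OF assms(1)] split: if_splits)
  then have "set (take k w) \<subseteq> B" "set (drop k w) \<subseteq> B" "length (drop k w) = l"
    using homogD[OF assms(1)] homogD[OF assms(2)] by blast+
  moreover have "set w = set (take k w) \<union> set (drop k w)"
    by (metis append_take_drop_id set_append)
  ultimately show "length w = k + l \<and> set w \<subseteq> B"
    using * by auto
qed

lemma slice_homog:
  assumes "t \<in> homog (length a + n + length b)"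
  shows "slice n a b t \<in> homog n"
proof (rule homogI)
  fix w assume "slice n a b t w \<noteq> 0"
  then show "length w = n \<and> set w \<subseteq> B"
    using homogD[OF assms, of "a @ w @ b"] by (auto simp: slice_def split: if_splits)
qed

text \<open>
  A tensor is the sum of its slices in front of the words \<open>b\<close>, each multiplied by \<open>b\<close>.
\<close>

lemma tprod_homog_right:
  assumes U: "tsubspace U" "U \<subseteq> homog k"
  shows "tprod U (homog l) = {t \<in> homog (k + l). \<forall>b. length b = l \<longrightarrow> slice k [] b t \<in> U}" (is "_ = ?S")
proof
  have "?S = {t \<in> homog (k + l). \<forall>a b. a = [] \<and> length b = l \<longrightarrow> slice k a b t \<in> U}"
    by auto
  then have "tsubspace ?S"
    using subspace_slices[OF subspace_homog U(1), of "k+l" "\<lambda>a b. a = [] \<and> length b = l" k] by simp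
  moreover have "tmult u w \<in> ?S" if "u \<in> U" "w \<in> homog l" for u w
  proof -
    have u: "u \<in> homog k" using that U by auto
    have "slice k [] b (tmult u w) = tscale (w b) u" for b
      using homogD[OF u] by (auto simp: tensor_apply fun_eq_iff slice_def tmult_homog_left[OF u])
    then show ?thesis
      using tmult_homog[OF u that(2)] U(1) that(1) by (auto simp: T.subspace_scale)
  qed
  ultimately show "tprod U (homog l) \<subseteq> ?S"
    unfolding tprod_def by (intro T.span_minimal) auto
  show "?S \<subseteq> tprod U (homog l)"
  proof
    fix t assume t: "t \<in> ?S"
    have sl: "slice k [] b t \<in> homog k" if "b \<in> words l" for b
      using t that by (intro slice_homog) (auto simp: words_def)
    have "t = (\<Sum>b\<in>words l. tmult (slice k [] b t) (word_tensor b))"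
    proof
      fix w
      have "(\<Sum>b\<in>words l. tmult (slice k [] b t) (word_tensor b)) w =
          (\<Sum>b\<in>words l. if b = drop k w then (if k \<le> length w then t w else 0) else 0)"
        unfolding sum_fun_apply
      proof (rule sum.cong[OF refl])
        fix b assume "b \<in> words l"
        then show "tmult (slice k [] b t) (word_tensor b) w =
            (if b = drop k w then (if k \<le> length w then t w else 0) else 0)"
          unfolding tmult_homog_left[OF sl[OF \<open>b \<in> words l\<close>]]
          by (auto simp: slice_def word_tensor_def)
      qed
      also have "\<dots> = (if drop k w \<in> words l \<and> k \<le> length w then t w else 0)"
        by (simp add: finite_words)
      also have "\<dots> = t w"
        using t homogD[of t "k + l" w] by (cases "t w = 0") (auto simp: words_def dest: in_set_dropD)
      finally show "t w = (\<Sum>b\<in>words l. tmult (slice k [] b t) (word_tensor b)) w" ..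
    qed
    moreover have "\<dots> \<in> tprod U (homog l)"
      unfolding tprod_def using t word_tensor_homog
      by (intro T.span_sum T.span_base) (auto simp: words_def)
    ultimately show "t \<in> tprod U (homog l)" by simp
  qed
qed

lemma tprod_homog_left:
  assumes U: "tsubspace U" "U \<subseteq> homog k"
  shows "tprod (homog l) U = {t \<in> homog (l + k). \<forall>a. length a = l \<longrightarrow> slice k a [] t \<in> U}" (is "_ = ?S")
proof
  have "?S = {t \<in> homog (l + k). \<forall>a b. b = [] \<and> length a = l \<longrightarrow> slice k a b t \<in> U}"
    by auto
  then have "tsubspace ?S"
    using subspace_slices[OF subspace_homog U(1), of "l+k" "\<lambda>a b. b = [] \<and> length a = l" k] by simp
  moreover have "tmult w u \<in> ?S" if "u \<in> U" "w \<in> homog l" for u w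
  proof -
    have u: "u \<in> homog k" using that U by auto
    have "slice k a [] (tmult w u) = tscale (w a) u" if "length a = l" for a
      using homogD[OF u] that by (auto simp: tensor_apply fun_eq_iff slice_def tmult_homog_left[OF \<open>w \<in> homog l\<close>])
    then show ?thesis
      using tmult_homog[OF that(2) u] U(1) that(1) by (auto simp: T.subspace_scale)
  qed
  ultimately show "tprod (homog l) U \<subseteq> ?S"
    unfolding tprod_def by (intro T.span_minimal) auto
  show "?S \<subseteq> tprod (homog l) U"
  proof
    fix t assume t: "t \<in> ?S"
    have "t = (\<Sum>a\<in>words l. tmult (word_tensor a) (slice k a [] t))"
    proof
      fix w
      have "(\<Sum>a\<in>words l. tmult (word_tensor a) (slice k a [] t)) w =
          (\<Sum>a\<in>words l. if a = take l w then (if length w = l + k then t w else 0) else 0)"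
        unfolding sum_fun_apply
      proof (rule sum.cong[OF refl])
        fix a assume "a \<in> words l"
        then have [simp]: "length a = l" by (simp add: words_def)
        show "tmult (word_tensor a) (slice k a [] t) w =
            (if a = take l w then (if length w = l + k then t w else 0) else 0)"
          unfolding tmult_homog_left[OF word_tensor_homog[OF \<open>a \<in> words l\<close>]]
          by (auto simp: slice_def word_tensor_def)
      qed
      also have "\<dots> = (if take l w \<in> words l \<and> length w = l + k then t w else 0)"
        by (simp add: finite_words)
      also have "\<dots> = t w"
        using t homogD[of t "l + k" w] by (cases "t w = 0") (auto simp: words_def dest: in_set_takeD)
      finally show "t w = (\<Sum>a\<in>words l. tmult (word_tensor a) (slice k a [] t)) w" ..
    qed
    moreover have "\<dots> \<in> tprod (homog l) U"
      unfolding tprod_def using t word_tensor_homog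
      by (intro T.span_sum T.span_base) (auto simp: words_def)
    ultimately show "t \<in> tprod (homog l) U" by simp
  qed
qed

lemma tprod_homog: "tprod (homog k) (homog l) = homog (k + l)"
  using tprod_homog_right[OF subspace_homog order_refl, of k l]
  by (auto intro!: slice_homog)

lemma vec_basis: "b \<in> B \<Longrightarrow> vec s B b = word_tensor [b]"
  unfolding vec_def word_tensor_def
  by (auto simp: tensor_apply fun_eq_iff V.representation_basis[OF V.independent_Basis] split: list.splits)

text \<open>
  Every function on \<open>B\<close> consists of the coordinates of some vector, as \<open>B\<close> is a finite basis.
\<close>

lemma range_vec: "range (vec s B) = homog 1"
proof
  show "range (vec s B) \<subseteq> homog 1"
    by (auto intro!: homogI simp: vec_def split: list.splits dest: V.representation_ne_zero)
  show "homog 1 \<subseteq> range (vec s B)"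
  proof
    fix t assume t: "t \<in> homog 1"
    define v where "v = (\<Sum>b\<in>B. s (t [b]) b)"
    have "V.representation B v = (\<lambda>b. t [b])"
    proof (rule V.representation_eqI[OF V.independent_Basis])
      show "v \<in> V.span B"
        using V.span_Basis by simp
      show "b \<in> B" if "t [b] \<noteq> 0" for b
        using homogD[OF t that] by simp
      then have sub: "{b. t [b] \<noteq> 0} \<subseteq> B" by auto
      then show "finite {b. t [b] \<noteq> 0}"
        using V.finite_Basis finite_subset by blast
      show "(\<Sum>b | t [b] \<noteq> 0. s (t [b]) b) = v"
        unfolding v_def by (rule sum.mono_neutral_left[OF V.finite_Basis sub]) auto
    qed
    moreover have "t w = 0" if "length w \<noteq> 1" for w
      using homogD[OF t] that by blast
    ultimately have "t = vec s B v"
      unfolding vec_def by (auto simp: fun_eq_iff split: list.splits)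
    then show "t \<in> range (vec s B)" by blast
  qed
qed

lemma Vpow_eq: "Vpow s B n = homog n"
proof (induction n)
  case 0
  have "tspan {tone} = homog 0"
  proof
    show "tspan {tone} \<subseteq> homog 0"
      by (intro T.span_minimal subspace_homog) (auto intro!: homogI simp: tone_def split: if_splits)
    show "homog 0 \<subseteq> tspan {tone}"
    proof
      fix t assume t: "t \<in> homog 0"
      have "t = tscale (t []) tone"
        using homogD[OF t] by (auto simp: tensor_apply fun_eq_iff tone_def)
      then show "t \<in> tspan {tone}"
        by (metis T.span_base T.span_scale singletonI)
    qed
  qed
  then show ?case by simp
next
  case (Suc n)
  then show ?case
    using range_vec tprod_homog[of 1 n] by simp
qed

lemma place_eq:
  assumes R: "tsubspace R" "R \<subseteq> homog N" and i: "i \<in> {1..n + 1 - N}"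
  shows "place s B N R n i = {t \<in> homog n. \<forall>a b. length a = i - 1 \<and> length b = n + 1 - N - i
    \<longrightarrow> slice N a b t \<in> R}"
proof -
  define k l where "k = i - 1" and "l = n + 1 - N - i"
  have n: "n = k + N + l"
    using i unfolding k_def l_def by auto
  define U where "U = tprod (homog k) R"
  have U: "U = {t \<in> homog (k + N). \<forall>a. length a = k \<longrightarrow> slice N a [] t \<in> R}"
    unfolding U_def by (rule tprod_homog_left[OF R])
  have subU: "tsubspace U"
    unfolding U_def by (rule subspace_tprod)
  have "place s B N R n i = tprod U (homog l)"
    unfolding place_def U_def Vpow_eq k_def l_def ..
  also have "\<dots> = {t \<in> homog n. \<forall>b. length b = l \<longrightarrow> slice (k + N) [] b t \<in> U}"
    unfolding n by (rule tprod_homog_right[OF subU]) (simp add: U subset_iff)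
  also have "\<dots> = {t \<in> homog n. \<forall>a b. length a = k \<and> length b = l \<longrightarrow> slice N a b t \<in> R}"
    unfolding U n by (auto simp: slice_slice intro!: slice_homog)
  finally show ?thesis
    unfolding k_def l_def .
qed

lemma subspace_place: "tsubspace (place s B N R n i)"
  unfolding place_def by (rule subspace_tprod)

lemma place_homog:
  assumes "tsubspace R" "R \<subseteq> homog N" "i \<in> {1..n + 1 - N}"
  shows "place s B N R n i \<subseteq> homog n"
  unfolding place_eq[OF assms] by auto

lemma place_span_UN:
  "place s B N (tspan (\<Union>j\<in>I. X j)) n i = tspan (\<Union>j\<in>I. place s B N (X j) n i)"
  unfolding place_def Vpow_eq by (simp add: tprod_UN_right tprod_UN_left subspace_homog)

lemma place_Int:
  assumes "tsubspace X" "X \<subseteq> homog N" "tsubspace Y" "Y \<subseteq> homog N" "i \<in> {1..n + 1 - N}"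
  shows "place s B N (X \<inter> Y) n i = place s B N X n i \<inter> place s B N Y n i"
proof -
  have "tsubspace (X \<inter> Y)" "X \<inter> Y \<subseteq> homog N"
    using assms by (auto simp: T.subspace_inter)
  then show ?thesis
    using assms by (auto simp: place_eq)
qed

lemma place_INT:
  assumes "\<And>j. j \<in> I \<Longrightarrow> tsubspace (X j)" "\<And>j. j \<in> I \<Longrightarrow> X j \<subseteq> homog N" "I \<noteq> {}" "i \<in> {1..n + 1 - N}"
  shows "place s B N (\<Inter>j\<in>I. X j) n i = (\<Inter>j\<in>I. place s B N (X j) n i)"
proof -
  have "tsubspace (\<Inter>j\<in>I. X j)" "(\<Inter>j\<in>I. X j) \<subseteq> homog N"
    using assms by (auto intro!: T.subspace_Int)
  then show ?thesis
    using assms by (auto simp: place_eq)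
qed

lemma place_plus:
  assumes "tsubspace X" "tsubspace Y"
  shows "place s B N (X + Y) n i = place s B N X n i + place s B N Y n i"
  using place_span_UN[of N "\<lambda>Z. Z" "{X, Y}" n i] assms subspace_place
  by (simp add: T.plus_eq_span)

text \<open>
  Both sides are described by slices of degree \<open>M\<close>: cutting a slice of degree \<open>N\<close> between
  \<open>a\<close> and \<open>b\<close>, and then one of degree \<open>M\<close> out of it, is cutting once between longer words.
\<close>

lemma place_place:
  assumes R: "tsubspace R" "R \<subseteq> homog M" and j: "j \<in> {1..N + 1 - M}" and i: "i \<in> {1..n + 1 - N}"
  shows "place s B N (place s B M R N j) n i = place s B M R n (i + j - 1)"
proof -
  have ij: "i + j - 1 \<in> {1..n + 1 - M}"
    using i j by auto
  have len: "length a = i + j - 1 - 1 \<and> length b = n + 1 - M - (i + j - 1) \<longleftrightarrow>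
     (\<exists>a1 a2 b1 b2. a = a1 @ a2 \<and> b = b2 @ b1 \<and> length a1 = i - 1 \<and> length b1 = n + 1 - N - i \<and>
       length a2 = j - 1 \<and> length b2 = N + 1 - M - j)" for a b :: "'v list"
  proof
    assume *: "length a = i + j - 1 - 1 \<and> length b = n + 1 - M - (i + j - 1)"
    show "\<exists>a1 a2 b1 b2. a = a1 @ a2 \<and> b = b2 @ b1 \<and> length a1 = i - 1 \<and> length b1 = n + 1 - N - i \<and>
       length a2 = j - 1 \<and> length b2 = N + 1 - M - j"
      by (rule exI[of _ "take (i - 1) a"], rule exI[of _ "drop (i - 1) a"],
          rule exI[of _ "drop (N + 1 - M - j) b"], rule exI[of _ "take (N + 1 - M - j) b"])
        (use * i j in auto)
  qed (use i j in auto)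
  have hom: "slice N a b t \<in> homog N" if "t \<in> homog n" "length a = i - 1" "length b = n + 1 - N - i" for a b t
    using that i by (intro slice_homog) auto
  have ss: "slice M a2 b2 (slice N a b t) = slice M (a @ a2) (b2 @ b) t"
    if "length a2 = j - 1" "length b2 = N + 1 - M - j" for a a2 b b2 t
    using that j by (intro slice_slice) auto
  show ?thesis (is "?L = ?R")
  proof (rule Set.set_eqI)
    fix t
    have "t \<in> ?L \<longleftrightarrow> t \<in> homog n \<and> (\<forall>a b. length a = i - 1 \<and> length b = n + 1 - N - i \<longrightarrow>
        (\<forall>a2 b2. length a2 = j - 1 \<and> length b2 = N + 1 - M - j \<longrightarrow>
          slice M (a @ a2) (b2 @ b) t \<in> R))"
      unfolding place_eq[OF subspace_place place_homog[OF R j] i]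
      unfolding place_eq[OF R j]
      using hom[of t] ss[of _ _ _ _ t] by auto
    also have "\<dots> \<longleftrightarrow> t \<in> ?R"
      unfolding place_eq[OF R ij] len by blast
    finally show "t \<in> ?L \<longleftrightarrow> t \<in> ?R" .
  qed
qed

section \<open>Products of adapted bases\<close>

text \<open>
  For a fixed word \<open>v\<close>, evaluating the second factors at \<open>v\<close> turns the relation into one
  between elements of \<open>\<beta>\<close>; its coefficients vanish, for every \<open>v\<close>, which is a relation between
  elements of \<open>\<beta>'\<close>.
\<close>

lemma independent_pairs:
  fixes c :: "('v, 'k) tensor \<times> ('v, 'k) tensor \<Rightarrow> 'k"
  assumes \<beta>: "T.independent \<beta>" "\<beta> \<subseteq> homog k" and \<beta>': "T.independent \<beta>'"
    and P: "finite P" "P \<subseteq> \<beta> \<times> \<beta>'"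
    and z: "(\<Sum>p\<in>P. tscale (c p) (tmult (fst p) (snd p))) = 0" and p: "p \<in> P"
  shows "c p = 0"
proof -
  define c' where "c' q = (if q \<in> P then c q else 0)" for q
  define g where "g b = (\<Sum>b'\<in>snd ` P. tscale (c' (b, b')) b')" for b
  have sub: "P \<subseteq> fst ` P \<times> snd ` P"
    by (auto simp: image_iff) (metis fst_conv, metis snd_conv)
  have fin: "finite (fst ` P)" "finite (snd ` P)"
    using P by auto
  have "(\<Sum>b\<in>fst ` P. tmult b (g b)) =
      (\<Sum>b\<in>fst ` P. \<Sum>b'\<in>snd ` P. tscale (c' (b, b')) (tmult b b'))"
    unfolding g_def tmult_sum_right tmult_scale_right ..
  also have "\<dots> = (\<Sum>q\<in>fst ` P \<times> snd ` P. tscale (c' q) (tmult (fst q) (snd q)))"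
    by (simp add: sum.cartesian_product case_prod_beta)
  also have "\<dots> = (\<Sum>q\<in>P. tscale (c' q) (tmult (fst q) (snd q)))"
    using fin sub by (intro sum.mono_neutral_right) (auto simp: c'_def)
  also have "\<dots> = 0"
    using z by (simp add: c'_def)
  finally have 0: "(\<Sum>b\<in>fst ` P. tmult b (g b)) = 0" .
  have "g b v = 0" if b: "b \<in> fst ` P" for b v
  proof (rule T.independentD[OF \<beta>(1) fin(1) _ _ b, of "\<lambda>b. g b v"])
    show "fst ` P \<subseteq> \<beta>" using P by auto
    then have hom: "d \<in> homog k" if "d \<in> fst ` P" for d
      using that \<beta> by auto
    show "(\<Sum>b\<in>fst ` P. tscale (g b v) b) = 0"
    proof
      fix u
      show "(\<Sum>b\<in>fst ` P. tscale (g b v) b) u = 0 u"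
      proof (cases "length u = k")
        case True
        have "(\<Sum>b\<in>fst ` P. tscale (g b v) b) u = (\<Sum>b\<in>fst ` P. tmult b (g b)) (u @ v)"
          unfolding sum_fun_apply using True
          by (intro sum.cong refl) (simp add: tmult_homog_left[OF hom] tscale_apply)
        then show ?thesis
          by (simp add: 0 zero_fun_apply)
      next
        case False
        then have "b u = 0" if "b \<in> fst ` P" for b
          using homogD[OF hom[OF that], of u] by blast
        then show ?thesis
          unfolding sum_fun_apply zero_fun_apply by (intro sum.neutral) (simp add: tscale_apply)
      qed
    qed
  qed
  then have "g (fst p) = 0"
    using p by (auto simp: fun_eq_iff zero_fun_apply)
  then have "c' (fst p, snd p) = 0"
    using P p unfolding g_def
    by (intro T.independentD[OF \<beta>' fin(2), of "\<lambda>b'. c' (fst p, b')" "snd p"]) auto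
  then show ?thesis
    using p by (simp add: c'_def)
qed

lemma independent_products:
  assumes \<beta>: "T.independent \<beta>" "\<beta> \<subseteq> homog k" and \<beta>': "T.independent \<beta>'"
  shows "T.independent ((\<lambda>(b, b'). tmult b b') ` (\<beta> \<times> \<beta>'))"
proof -
  let ?m = "\<lambda>(b, b'). tmult b b'"
  have inj: "inj_on ?m (\<beta> \<times> \<beta>')"
  proof (rule inj_onI, rule ccontr)
    fix p q assume pq: "p \<in> \<beta> \<times> \<beta>'" "q \<in> \<beta> \<times> \<beta>'" "?m p = ?m q" "p \<noteq> q"
    \<comment> \<open>Two pairs with the same product would satisfy a relation with coefficients \<open>1\<close> and \<open>-1\<close>.\<close>
    have "(\<Sum>r\<in>{p, q}. tscale (if r = p then 1 else - 1) (tmult (fst r) (snd r))) = 0"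
      using pq by (simp add: case_prod_beta)
    then have "(if p = p then 1 else - 1 :: 'k) = 0"
      using pq by (intro independent_pairs[OF \<beta> \<beta>', of "{p, q}" "\<lambda>r. if r = p then 1 else - 1"]) auto
    then show False by simp
  qed
  show ?thesis
    unfolding T.independent_explicit_module
  proof (intro allI impI)
    fix t u v
    assume t: "finite t" "t \<subseteq> ?m ` (\<beta> \<times> \<beta>')" and z: "(\<Sum>v\<in>t. tscale (u v) v) = 0" and v: "v \<in> t"
    obtain P where P: "P \<subseteq> \<beta> \<times> \<beta>'" "finite P" "t = ?m ` P"
      using finite_subset_image[OF t] by auto
    have "inj_on ?m P"
      using inj P(1) by (rule inj_on_subset)
    then have "(\<Sum>v\<in>t. tscale (u v) v) = (\<Sum>p\<in>P. tscale (u (?m p)) (?m p))"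
      unfolding P(3) by (rule sum.reindex[unfolded comp_def])
    then have "(\<Sum>p\<in>P. tscale (u (?m p)) (tmult (fst p) (snd p))) = 0"
      using z by (simp add: case_prod_beta)
    moreover obtain p where "p \<in> P" "v = ?m p"
      using v P(3) by auto
    ultimately show "u v = 0"
      using independent_pairs[OF \<beta> \<beta>' P(2,1), of "\<lambda>p. u (?m p)" p] by simp
  qed
qed

lemma distributive_family_tprod:
  assumes X: "T.distributive_family (homog k) S X" and Y: "T.distributive_family (homog l) S' Y"
  shows "\<exists>\<beta>. T.independent \<beta> \<and> tspan \<beta> = homog (k + l) \<and>
    (\<forall>i\<in>S. tprod (X i) (homog l) \<in> T.coordinate_subspaces \<beta>) \<and>
    (\<forall>j\<in>S'. tprod (homog k) (Y j) \<in> T.coordinate_subspaces \<beta>)"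
proof -
  obtain \<beta> where \<beta>: "T.independent \<beta>" "tspan \<beta> = homog k" "\<forall>i\<in>S. X i \<in> T.coordinate_subspaces \<beta>"
    using X unfolding T.distributive_family_def by blast
  obtain \<beta>' where \<beta>': "T.independent \<beta>'" "tspan \<beta>' = homog l" "\<forall>i\<in>S'. Y i \<in> T.coordinate_subspaces \<beta>'"
    using Y unfolding T.distributive_family_def by blast
  let ?m = "\<lambda>\<gamma> \<gamma>'. (\<lambda>(b, b'). tmult b b') ` (\<gamma> \<times> \<gamma>')"
  have m: "tprod (tspan \<gamma>) (tspan \<gamma>') = tspan (?m \<gamma> \<gamma>')" for \<gamma> \<gamma>' :: "('v, 'k) tensor set"
    unfolding tprod_span by (rule arg_cong[of _ _ tspan]) auto
  have ind: "T.independent (?m \<beta> \<beta>')"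
    using \<beta> \<beta>' T.span_superset[of \<beta>] by (intro independent_products[of _ k]) auto
  have sp: "tspan (?m \<beta> \<beta>') = homog (k + l)"
    using m[of \<beta> \<beta>'] \<beta> \<beta>' tprod_homog by simp
  have 1: "tprod (X i) (homog l) \<in> T.coordinate_subspaces (?m \<beta> \<beta>')" if "i \<in> S" for i
  proof -
    obtain \<gamma> where \<gamma>: "\<gamma> \<subseteq> \<beta>" "X i = tspan \<gamma>"
      using \<beta>(3) \<open>i \<in> S\<close> unfolding T.coordinate_subspaces_def by blast
    have "tprod (X i) (homog l) = tspan (?m \<gamma> \<beta>')"
      using m[of \<gamma> \<beta>'] \<gamma> \<beta>' by simp
    moreover have "?m \<gamma> \<beta>' \<subseteq> ?m \<beta> \<beta>'"
      using \<gamma> by auto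
    ultimately show ?thesis
      by (simp only: T.coordinate_subspacesI)
  qed
  have 2: "tprod (homog k) (Y j) \<in> T.coordinate_subspaces (?m \<beta> \<beta>')" if "j \<in> S'" for j
  proof -
    obtain \<gamma> where \<gamma>: "\<gamma> \<subseteq> \<beta>'" "Y j = tspan \<gamma>"
      using \<beta>'(3) \<open>j \<in> S'\<close> unfolding T.coordinate_subspaces_def by blast
    have "tprod (homog k) (Y j) = tspan (?m \<beta> \<gamma>)"
      using m[of \<beta> \<gamma>] \<gamma> \<beta> by simp
    moreover have "?m \<beta> \<gamma> \<subseteq> ?m \<beta> \<beta>'"
      using \<gamma> by auto
    ultimately show ?thesis
      by (simp only: T.coordinate_subspacesI)
  qed
  show ?thesis
    using ind sp 1 2 by blast
qed

end

section \<open>The tensor algebra and its quotients\<close>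

lemma tmult_assoc: "tmult (tmult t u) v = tmult t (tmult u v)"
proof
  fix w :: "'a list"
  let ?n = "length w"
  have "tmult (tmult t u) v w =
      (\<Sum>i\<le>?n. \<Sum>j\<le>i. t (take j w) * u (take (i - j) (drop j w)) * v (drop i w))"
    unfolding tmult_def
    by (intro sum.cong refl) (auto simp: sum_distrib_right min_def drop_take intro!: sum.cong)
  also have "\<dots> = (\<Sum>(i, j)\<in>(SIGMA i:{..?n}. {..i}). t (take j w) * u (take (i - j) (drop j w)) * v (drop i w))"
    by (simp add: sum.Sigma)
  also have "\<dots> = (\<Sum>(j, m)\<in>(SIGMA j:{..?n}. {..?n - j}). t (take j w) * u (take m (drop j w)) * v (drop (m + j) w))"
    by (rule sum.reindex_bij_witness[of _ "\<lambda>(j, m). (m + j, j)" "\<lambda>(i, j). (j, i - j)"]) auto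
  also have "\<dots> = (\<Sum>j\<le>?n. \<Sum>m\<le>?n - j. t (take j w) * u (take m (drop j w)) * v (drop (m + j) w))"
    by (simp add: sum.Sigma)
  also have "\<dots> = tmult t (tmult u v) w"
    unfolding tmult_def
    by (intro sum.cong refl) (auto simp: sum_distrib_left mult.assoc intro!: sum.cong)
  finally show "tmult (tmult t u) v w = tmult t (tmult u v) w" .
qed

definition degree_part :: "nat \<Rightarrow> ('v, 'k::field) tensor \<Rightarrow> ('v, 'k) tensor" where
  "degree_part n t = (\<lambda>w. if length w = n then t w else 0)"

lemma degree_part_add: "degree_part n (t + u) = degree_part n t + degree_part n u"
  by (auto simp: degree_part_def tensor_apply fun_eq_iff)

lemma degree_part_diff: "degree_part n (t - u) = degree_part n t - degree_part n u"
  by (auto simp: degree_part_def tensor_apply fun_eq_iff)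

lemma degree_part_scale: "degree_part n (tscale c t) = tscale c (degree_part n t)"
  by (auto simp: degree_part_def tensor_apply fun_eq_iff)

lemma degree_part_0 [simp]: "degree_part n 0 = 0"
  by (auto simp: degree_part_def tensor_apply fun_eq_iff)

lemma degree_part_sum: "degree_part n (sum f A) = (\<Sum>i\<in>A. degree_part n (f i))"
  by (induction A rule: infinite_finite_induct) (auto simp: degree_part_add)

lemma degree_part_tmult: "degree_part n (tmult t u) = (\<Sum>i\<le>n. tmult (degree_part i t) (degree_part (n - i) u))"
proof
  fix w
  show "degree_part n (tmult t u) w = (\<Sum>i\<le>n. tmult (degree_part i t) (degree_part (n - i) u)) w"
  proof (cases "length w = n")
    case True
    have "tmult (degree_part i t) (degree_part (n - i) u) w = t (take i w) * u (drop i w)" if "i \<le> n" for i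
    proof -
      have "tmult (degree_part i t) (degree_part (n - i) u) w =
        (\<Sum>j\<le>n. if j = i then t (take i w) * u (drop i w) else 0)"
        unfolding tmult_def degree_part_def using True that by (intro sum.cong) auto
      then show ?thesis using that by simp
    qed
    then show ?thesis
      using True by (simp add: sum_fun_apply degree_part_def tmult_def)
  next
    case False
    have "tmult (degree_part i t) (degree_part (n - i) u) w = 0" if "i \<le> n" for i
      unfolding tmult_def degree_part_def using False that by (intro sum.neutral) auto
    then show ?thesis
      using False by (simp add: sum_fun_apply degree_part_def)
  qed
qed

context tensor_setting
begin

lemma degree_part_homog: "t \<in> homog k \<Longrightarrow> degree_part n t = (if n = k then t else 0)"
  using homogD[of t k] by (auto simp: degree_part_def tensor_apply fun_eq_iff)

text \<open>
  Tensors of bounded degree. Since \<open>B\<close> is finite, these are the functions of finite support on the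
  words over \<open>B\<close>, hence the carrier of the tensor algebra (\<open>carrier_tensor_algebra\<close>).
\<close>

definition tensors :: "('v, 'k) tensor set" where
  "tensors = {t. \<exists>L. \<forall>w. t w \<noteq> 0 \<longrightarrow> length w \<le> L \<and> set w \<subseteq> B}"

lemma homog_tensors: "homog n \<subseteq> tensors"
  unfolding tensors_def using homogD by fastforce

lemma subspace_tensors: "tsubspace tensors"
  unfolding T.subspace_def
proof (intro conjI ballI allI)
  show "0 \<in> tensors"
    by (auto simp: tensors_def tensor_apply)
next
  fix t u assume "t \<in> tensors" "u \<in> tensors"
  then obtain L M where "\<forall>w. t w \<noteq> 0 \<longrightarrow> length w \<le> L \<and> set w \<subseteq> B"
    "\<forall>w. u w \<noteq> 0 \<longrightarrow> length w \<le> M \<and> set w \<subseteq> B"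
    unfolding tensors_def by blast
  then have "\<forall>w. (t + u) w \<noteq> 0 \<longrightarrow> length w \<le> max L M \<and> set w \<subseteq> B"
    by (metis add.right_neutral max.coboundedI1 max.coboundedI2 plus_fun_apply)
  then show "t + u \<in> tensors"
    unfolding tensors_def by blast
next
  fix c t assume "t \<in> tensors"
  then show "tscale c t \<in> tensors"
    unfolding tensors_def by (auto simp: tscale_apply)
qed

lemma degree_part_in_homog: "t \<in> tensors \<Longrightarrow> degree_part n t \<in> homog n"
  unfolding tensors_def by (auto intro!: homogI simp: degree_part_def split: if_splits)

lemma tensors_expand:
  assumes "t \<in> tensors"
  obtains L where "t = (\<Sum>n\<le>L. degree_part n t)" "\<And>n. n > L \<Longrightarrow> degree_part n t = 0"
proof -
  obtain L where L: "\<forall>w. t w \<noteq> 0 \<longrightarrow> length w \<le> L \<and> set w \<subseteq> B"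
    using assms unfolding tensors_def by blast
  have "t = (\<Sum>n\<le>L. degree_part n t)"
    using L by (auto simp: fun_eq_iff sum_fun_apply degree_part_def)
  moreover have "degree_part n t = 0" if "n > L" for n
    using L that by (auto simp: fun_eq_iff degree_part_def tensor_apply)
  ultimately show ?thesis using that by blast
qed

lemma tmult_tensors:
  assumes "t \<in> tensors" "u \<in> tensors"
  shows "tmult t u \<in> tensors"
proof -
  obtain L M where t: "t = (\<Sum>n\<le>L. degree_part n t)" and u: "u = (\<Sum>n\<le>M. degree_part n u)"
    using tensors_expand assms by metis
  have "tmult t u = (\<Sum>i\<le>L. \<Sum>j\<le>M. tmult (degree_part i t) (degree_part j u))"
    by (subst t, subst u) (simp add: tmult_sum_left tmult_sum_right sum.swap[of _ "{..M}"])
  also have "\<dots> \<in> tensors"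
    using tmult_homog[OF degree_part_in_homog[OF assms(1)] degree_part_in_homog[OF assms(2)]] homog_tensors
    by (intro T.subspace_sum subspace_tensors) blast
  finally show ?thesis .
qed

lemma tone_homog: "tone \<in> homog 0"
  by (auto intro!: homogI simp: tone_def split: if_splits)

lemma tmult_tone_left: "tmult tone t = t" for t :: "('v, 'k) tensor"
  by (auto simp: fun_eq_iff tmult_homog_left[OF tone_homog]) (simp add: tone_def)

lemma tmult_tone_right: "tmult t tone = t" for t :: "('v, 'k) tensor"
  by (auto simp: fun_eq_iff tmult_homog_right[OF tone_homog]) (simp add: tone_def)

lemma carrier_tensor_algebra: "carrier (tensor_algebra s B) = tensors"
proof -
  have "tspan (\<Union>n. homog n) = tensors"
  proof
    show "tspan (\<Union>n. homog n) \<subseteq> tensors"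
      using homog_tensors by (intro T.span_minimal subspace_tensors) auto
    show "tensors \<subseteq> tspan (\<Union>n. homog n)"
    proof
      fix t assume t: "t \<in> tensors"
      obtain L where "t = (\<Sum>n\<le>L. degree_part n t)"
        using tensors_expand[OF t] .
      moreover have "\<dots> \<in> tspan (\<Union>n. homog n)"
        using degree_part_in_homog[OF t] by (intro T.span_sum T.span_base) auto
      ultimately show "t \<in> tspan (\<Union>n. homog n)" by simp
    qed
  qed
  then show ?thesis
    unfolding tensor_algebra_def by (simp add: Vpow_eq)
qed

lemma tensor_algebra_simps:
  "t \<otimes>\<^bsub>tensor_algebra s B\<^esub> u = tmult t u" "\<one>\<^bsub>tensor_algebra s B\<^esub> = tone"
  "\<zero>\<^bsub>tensor_algebra s B\<^esub> = 0" "t \<oplus>\<^bsub>tensor_algebra s B\<^esub> u = t + u"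
  by (simp_all add: tensor_algebra_def)

lemma ring_tensor_algebra: "ring (tensor_algebra s B)"
proof (rule ringI)
  show "abelian_group (tensor_algebra s B)"
  proof (rule abelian_groupI)
    fix x assume "x \<in> carrier (tensor_algebra s B)"
    then show "\<exists>y\<in>carrier (tensor_algebra s B). y \<oplus>\<^bsub>tensor_algebra s B\<^esub> x = \<zero>\<^bsub>tensor_algebra s B\<^esub>"
      unfolding carrier_tensor_algebra tensor_algebra_simps
      using subspace_tensors by (intro bexI[of _ "- x"]) (auto simp: T.subspace_neg)
  qed (use subspace_tensors in \<open>auto simp: carrier_tensor_algebra tensor_algebra_simps ac_simps
        T.subspace_add T.subspace_0\<close>)
  show "Group.monoid (tensor_algebra s B)"
    using tone_homog homog_tensors
    by (intro Group.monoidI) (auto simp: carrier_tensor_algebra tensor_algebra_simps tmult_tensors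
        tmult_assoc tmult_tone_left tmult_tone_right)
qed (auto simp: tensor_algebra_simps tmult_add_left tmult_add_right)

lemma tprod_homog_0_right: "tsubspace U \<Longrightarrow> U \<subseteq> homog k \<Longrightarrow> tprod U (homog 0) = U"
  using tprod_homog_right[of U k 0] degree_part_homog
  by (auto simp: slice_def degree_part_def[symmetric])

lemma tprod_homog_0_left: "tsubspace U \<Longrightarrow> U \<subseteq> homog k \<Longrightarrow> tprod (homog 0) U = U"
  using tprod_homog_left[of U k 0] degree_part_homog
  by (auto simp: slice_def degree_part_def[symmetric])

lemma place_first: "tsubspace X \<Longrightarrow> X \<subseteq> homog k \<Longrightarrow> place s B k X (k + l) 1 = tprod X (homog l)"
  unfolding place_def Vpow_eq by (simp add: tprod_homog_0_left)

lemma place_last: "tsubspace X \<Longrightarrow> X \<subseteq> homog k \<Longrightarrow> place s B k X (l + k) (l + 1) = tprod (homog l) X"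
  unfolding place_def Vpow_eq
  using tprod_homog_0_right[OF subspace_tprod, of "homog l" X "l + k"] tprod_homog_left[of X k l]
  by auto

lemma tprod_place_right:
  assumes R: "tsubspace R" "R \<subseteq> homog N" and i: "i \<in> {1..k + 1 - N}"
  shows "tprod (place s B N R k i) (homog l) = place s B N R (k + l) i"
  using place_first[OF subspace_place place_homog[OF R i], of l] place_place[OF R i, of 1 "k + l"]
  by simp

lemma tprod_place_left:
  assumes R: "tsubspace R" "R \<subseteq> homog N" and i: "i \<in> {1..k + 1 - N}"
  shows "tprod (homog l) (place s B N R k i) = place s B N R (l + k) (l + i)"
  using place_last[OF subspace_place place_homog[OF R i], of l] place_place[OF R i, of "l + 1" "l + k"]
  by simp

end

locale homogeneous_algebra = tensor_setting s B
  for s :: "'k::field \<Rightarrow> 'v::ab_group_add \<Rightarrow> 'v" and B :: "'v set" +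
  fixes N :: nat and R :: "('v, 'k) tensor set"
  assumes subspace_R: "tsubspace R" and R_homog: "R \<subseteq> homog N" and N: "2 \<le> N"
begin

abbreviation "X \<equiv> place s B N R"

text \<open>
  The ideal \<open>(R)\<close> (\<open>genideal_R\<close>) is graded, and in degree \<open>m\<close> it is the sum of the copies of
  \<open>R\<close> in \<open>V\<^bsup>\<otimes>m\<^esup>\<close>.
\<close>

definition I :: "('v, 'k) tensor set" where
  "I = {t \<in> tensors. \<forall>m. degree_part m t \<in> T.fjoin (X m) {1..m + 1 - N}}"

lemma subspace_I: "tsubspace I"
  using subspace_tensors T.subspace_fjoin[of "X _"]
  unfolding I_def T.subspace_def by (simp add: degree_part_add degree_part_scale)

lemma fjoin_homog: "P \<subseteq> {1..m + 1 - N} \<Longrightarrow> T.fjoin (X m) P \<subseteq> homog m"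
  unfolding T.fjoin_def using place_homog[OF subspace_R R_homog]
  by (intro T.span_minimal subspace_homog) blast

lemma tprod_fjoin_right:
  "tprod (T.fjoin (X m) {1..m + 1 - N}) (homog l) = T.fjoin (X (m + l)) {1..m + 1 - N}"
  unfolding T.fjoin_def tprod_UN_left[OF subspace_homog]
  using tprod_place_right[OF subspace_R R_homog] by simp

lemma tprod_fjoin_left:
  "tprod (homog l) (T.fjoin (X m) {1..m + 1 - N}) \<subseteq> T.fjoin (X (l + m)) {1..l + m + 1 - N}"
proof -
  have "tprod (homog l) (T.fjoin (X m) {1..m + 1 - N}) = T.fjoin (\<lambda>i. X (l + m) (l + i)) {1..m + 1 - N}"
    unfolding T.fjoin_def tprod_UN_right[OF subspace_homog]
    using tprod_place_left[OF subspace_R R_homog] by simp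
  also have "\<dots> \<subseteq> T.fjoin (X (l + m)) {1..l + m + 1 - N}"
    unfolding T.fjoin_def by (intro T.span_mono) force
  finally show ?thesis .
qed

lemma tmult_in_tprod: "u \<in> U \<Longrightarrow> w \<in> W \<Longrightarrow> tmult u w \<in> tprod U W"
  unfolding tprod_def by (rule T.span_base) blast

lemma fjoin_interval_mono: "a \<le> b \<Longrightarrow> T.fjoin (X m) {1..a} \<subseteq> T.fjoin (X m) {1..b}"
  by (intro T.fjoin_mono) auto

lemma R_eq_place: "X N 1 = R"
  using place_first[OF subspace_R R_homog, of 0] tprod_homog_0_right[OF subspace_R R_homog] by simp

lemma ideal_I: "ideal I (tensor_algebra s B)"
proof (rule idealI[OF ring_tensor_algebra])
  interpret A: ring "tensor_algebra s B" by (rule ring_tensor_algebra)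
  have neg: "\<ominus>\<^bsub>tensor_algebra s B\<^esub> t = - t" if "t \<in> tensors" for t
    using that subspace_tensors T.subspace_neg
    by (intro A.minus_equality) (auto simp: tensor_algebra_simps carrier_tensor_algebra)
  show "subgroup I (add_monoid (tensor_algebra s B))"
  proof (rule subgroup.intro)
    show "inv\<^bsub>add_monoid (tensor_algebra s B)\<^esub> x \<in> I" if "x \<in> I" for x
      using neg[of x] that T.subspace_neg[OF subspace_I that] unfolding a_inv_def I_def by auto
    show "I \<subseteq> carrier (add_monoid (tensor_algebra s B))"
      by (auto simp: I_def carrier_tensor_algebra)
  qed (use subspace_I in \<open>auto simp: tensor_algebra_simps T.subspace_add T.subspace_0\<close>)
  fix t x assume t: "t \<in> I" and x: "x \<in> carrier (tensor_algebra s B)"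
  then have tx: "t \<in> tensors" "x \<in> tensors"
    by (auto simp: I_def carrier_tensor_algebra)
  have tm: "degree_part m t \<in> T.fjoin (X m) {1..m + 1 - N}" for m
    using t by (simp add: I_def)
  have "tmult (degree_part i x) (degree_part (m - i) t) \<in> T.fjoin (X m) {1..m + 1 - N}" if "i \<le> m" for i m
    using tmult_in_tprod[OF degree_part_in_homog[OF tx(2)] tm, of i "m - i"] tprod_fjoin_left[of i "m - i"] that
    by auto
  then have "degree_part m (tmult x t) \<in> T.fjoin (X m) {1..m + 1 - N}" for m
    unfolding degree_part_tmult by (intro T.subspace_sum T.subspace_fjoin) auto
  then show "x \<otimes>\<^bsub>tensor_algebra s B\<^esub> t \<in> I"
    using tx by (auto simp: tensor_algebra_simps I_def tmult_tensors)
  have "tmult (degree_part i t) (degree_part (m - i) x) \<in> T.fjoin (X m) {1..m + 1 - N}" if "i \<le> m" for i m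
    using tmult_in_tprod[OF tm degree_part_in_homog[OF tx(2)], of i "m - i"] tprod_fjoin_right[of i "m - i"] that
      subsetD[OF fjoin_interval_mono[of "i + 1 - N" "m + 1 - N" m]]
    by (auto simp: diff_le_mono)
  then have "degree_part m (tmult t x) \<in> T.fjoin (X m) {1..m + 1 - N}" for m
    unfolding degree_part_tmult by (intro T.subspace_sum T.subspace_fjoin) auto
  then show "t \<otimes>\<^bsub>tensor_algebra s B\<^esub> x \<in> I"
    using tx by (auto simp: tensor_algebra_simps I_def tmult_tensors)
qed

lemma genideal_R: "Idl\<^bsub>tensor_algebra s B\<^esub> R = I"
proof
  interpret A: ring "tensor_algebra s B" by (rule ring_tensor_algebra)
  have Rc: "R \<subseteq> carrier (tensor_algebra s B)"
    using R_homog homog_tensors by (auto simp: carrier_tensor_algebra)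
  have "R \<subseteq> I"
  proof
    fix t assume t: "t \<in> R"
    have "R \<subseteq> T.fjoin (X N) {1..N + 1 - N}"
      using R_eq_place T.span_superset unfolding T.fjoin_def by force
    then have "degree_part m t \<in> T.fjoin (X m) {1..m + 1 - N}" for m
      using t degree_part_homog[OF subsetD[OF R_homog t], of m] T.subspace_0[OF T.subspace_fjoin, of "X m"]
      by (cases "m = N") auto
    then show "t \<in> I"
      using Rc t by (auto simp: I_def carrier_tensor_algebra)
  qed
  then show "Idl\<^bsub>tensor_algebra s B\<^esub> R \<subseteq> I"
    by (rule A.genideal_minimal[OF ideal_I])
  interpret G: ideal "Idl\<^bsub>tensor_algebra s B\<^esub> R" "tensor_algebra s B"
    by (rule A.genideal_ideal[OF Rc])
  have mult: "tmult x t \<in> Idl\<^bsub>tensor_algebra s B\<^esub> R" "tmult t x \<in> Idl\<^bsub>tensor_algebra s B\<^esub> R"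
    if "t \<in> Idl\<^bsub>tensor_algebra s B\<^esub> R" "x \<in> tensors" for t x
    using G.I_l_closed[OF that(1)] G.I_r_closed[OF that(1)] that(2)
    by (auto simp: carrier_tensor_algebra tensor_algebra_simps)
  have sub: "tsubspace (Idl\<^bsub>tensor_algebra s B\<^esub> R)"
    unfolding T.subspace_def
  proof (intro conjI ballI allI)
    show "0 \<in> Idl\<^bsub>tensor_algebra s B\<^esub> R"
      using G.zero_closed by (simp add: tensor_algebra_simps)
    show "x + y \<in> Idl\<^bsub>tensor_algebra s B\<^esub> R"
      if "x \<in> Idl\<^bsub>tensor_algebra s B\<^esub> R" "y \<in> Idl\<^bsub>tensor_algebra s B\<^esub> R" for x y
      using G.a_closed[OF that] by (simp add: tensor_algebra_simps)
    show "tscale c x \<in> Idl\<^bsub>tensor_algebra s B\<^esub> R" if "x \<in> Idl\<^bsub>tensor_algebra s B\<^esub> R" for c x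
    proof -
      have "tscale c tone \<in> tensors"
        using tone_homog homog_tensors subspace_tensors by (auto intro!: T.subspace_scale)
      then show ?thesis
        using mult(1)[OF that, of "tscale c tone"] by (simp add: tmult_scale_left tmult_tone_left)
    qed
  qed
  have "X m i \<subseteq> Idl\<^bsub>tensor_algebra s B\<^esub> R" for m i
  proof -
    have "tprod (homog (i - 1)) R \<subseteq> Idl\<^bsub>tensor_algebra s B\<^esub> R"
      using mult(1) A.genideal_self[OF Rc] homog_tensors unfolding tprod_def
      by (intro T.span_minimal sub) blast
    then show ?thesis
      unfolding place_def Vpow_eq using mult(2) homog_tensors unfolding tprod_def[of _ "homog (m + 1 - N - i)"]
      by (intro T.span_minimal sub) blast
  qed
  then have join: "T.fjoin (X m) P \<subseteq> Idl\<^bsub>tensor_algebra s B\<^esub> R" for m P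
    unfolding T.fjoin_def by (intro T.span_minimal sub) blast
  show "I \<subseteq> Idl\<^bsub>tensor_algebra s B\<^esub> R"
  proof
    fix t assume t: "t \<in> I"
    then obtain L where "t = (\<Sum>n\<le>L. degree_part n t)"
      unfolding I_def using tensors_expand by blast
    moreover have "(\<Sum>n\<le>L. degree_part n t) \<in> Idl\<^bsub>tensor_algebra s B\<^esub> R"
      using t join by (intro T.subspace_sum sub) (auto simp: I_def)
    ultimately show "t \<in> Idl\<^bsub>tensor_algebra s B\<^esub> R" by simp
  qed
qed

end

section \<open>The Koszul complex in terms of tensors\<close>

text \<open>
  The coefficient of \<open>w\<close> if \<open>G\<close> is regarded as an element of \<open>TV \<otimes> V\<^bsup>\<otimes>n\<^esup>\<close> with
  \<open>n = length w\<close>.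
\<close>

definition tail :: "'v list \<Rightarrow> ('v, 'k::field) tensor \<Rightarrow> ('v, 'k) tensor" where
  "tail w G = (\<lambda>u. G (u @ w))"

lemma tail_diff: "tail w (G - H) = tail w G - tail w H"
  by (simp add: tail_def tensor_apply fun_eq_iff)

lemma degree_part_tail: "degree_part m (tail w G) = slice m [] w (degree_part (m + length w) G)"
  by (auto simp: tail_def degree_part_def slice_def fun_eq_iff)

lemma koszul_degree_0 [simp]: "koszul_degree N 0 = 0"
  and koszul_degree_1 [simp]: "koszul_degree N (Suc 0) = 1"
  and koszul_degree_step: "koszul_degree N (Suc (Suc j)) = koszul_degree N j + N"
  by (simp_all add: koszul_degree_def)

lemma koszul_degree_Suc:
  assumes "1 \<le> N"
  shows "koszul_degree N (Suc j) = koszul_degree N j + (if even j then 1 else N - 1)"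
  using assms by (cases "even j") (auto elim!: evenE oddE simp: koszul_degree_def)

context tensor_setting
begin

lemma tail_tensors:
  assumes "G \<in> tensors"
  shows "tail w G \<in> tensors"
proof -
  obtain L where L: "\<And>w. G w \<noteq> 0 \<Longrightarrow> length w \<le> L \<and> set w \<subseteq> B"
    using assms unfolding tensors_def by blast
  have "length u \<le> L \<and> set u \<subseteq> B" if "tail w G u \<noteq> 0" for u
    using L[of "u @ w"] that by (auto simp: tail_def)
  then have "\<forall>u. tail w G u \<noteq> 0 \<longrightarrow> length u \<le> L \<and> set u \<subseteq> B"
    by blast
  then show ?thesis
    unfolding tensors_def by blast
qed

text \<open>
  The product in \<open>TV\<close> identifies \<open>TV \<otimes> V\<^bsup>\<otimes>n\<^esup>\<close> with the tensors all of whose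
  components have degree at least \<open>n\<close>, and \<open>TV \<otimes> W\<close>, for \<open>W \<subseteq> V\<^bsup>\<otimes>n\<^esup>\<close>, with the subspace
  defined next.
\<close>

definition deep :: "nat \<Rightarrow> ('v, 'k) tensor set" where
  "deep n = {G \<in> tensors. \<forall>w. G w \<noteq> 0 \<longrightarrow> n \<le> length w}"

definition TV_tensor :: "nat \<Rightarrow> ('v, 'k) tensor set \<Rightarrow> ('v, 'k) tensor set" where
  "TV_tensor n W = {G \<in> deep n. \<forall>a. slice n a [] G \<in> W}"

lemma deep_iff: "G \<in> deep n \<longleftrightarrow> G \<in> tensors \<and> (\<forall>D<n. degree_part D G = 0)"
proof -
  have "(\<forall>w. G w \<noteq> 0 \<longrightarrow> n \<le> length w) \<longleftrightarrow> (\<forall>D<n. degree_part D G = 0)"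
  proof
    assume "\<forall>w. G w \<noteq> 0 \<longrightarrow> n \<le> length w"
    then show "\<forall>D<n. degree_part D G = 0"
      by (auto simp: degree_part_def fun_eq_iff tensor_apply)
  next
    assume *: "\<forall>D<n. degree_part D G = 0"
    show "\<forall>w. G w \<noteq> 0 \<longrightarrow> n \<le> length w"
    proof (intro allI impI, rule ccontr)
      fix w assume "G w \<noteq> 0" "\<not> n \<le> length w"
      then have "degree_part (length w) G w = 0"
        using * by (simp add: zero_fun_apply)
      then show False
        using \<open>G w \<noteq> 0\<close> by (simp add: degree_part_def)
    qed
  qed
  then show ?thesis
    unfolding deep_def by blast
qed

lemma homog_deep: "n \<le> D \<Longrightarrow> homog D \<subseteq> deep n"
  using subsetD[OF homog_tensors] by (auto simp: deep_iff degree_part_homog)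

lemma degree_part_sum_homog:
  assumes "\<And>D. h D \<in> homog D"
  shows "degree_part D (\<Sum>E\<le>L. h E) = (if D \<le> L then h D else 0)"
proof -
  have "degree_part D (\<Sum>E\<le>L. h E) = (\<Sum>E\<le>L. if E = D then h D else 0)"
    unfolding degree_part_sum using degree_part_homog[OF assms] by (intro sum.cong) auto
  then show ?thesis by simp
qed

lemma deep_antimono: "m \<le> n \<Longrightarrow> deep n \<subseteq> deep m"
  unfolding deep_def using order_trans by blast

lemma deep_tensors: "deep n \<subseteq> tensors"
  unfolding deep_def by blast

lemma subspace_deep: "tsubspace (deep n)"
  using subspace_tensors unfolding deep_def T.subspace_def
  by (auto simp: tensor_apply) force

lemma subspace_TV_tensor: "tsubspace W \<Longrightarrow> tsubspace (TV_tensor n W)"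
  using subspace_deep[of n] unfolding TV_tensor_def T.subspace_def
  by (auto simp: slice_add slice_scale slice_0)

lemma tmult_TV_tensor:
  assumes "\<alpha> \<in> tensors" "t \<in> W" "W \<subseteq> homog n" "tsubspace W"
  shows "tmult \<alpha> t \<in> TV_tensor n W"
proof -
  have t: "t \<in> homog n" using assms by auto
  have "slice n a [] (tmult \<alpha> t) = tscale (\<alpha> a) t" for a
    using homogD[OF t] by (auto simp: fun_eq_iff slice_def tmult_homog_right[OF t] tscale_apply)
  moreover have "n \<le> length w" if "tmult \<alpha> t w \<noteq> 0" for w
    using that by (simp add: tmult_homog_right[OF t] split: if_splits)
  ultimately show ?thesis
    using assms t homog_tensors[of n] unfolding TV_tensor_def deep_def
    by (auto simp: tmult_tensors T.subspace_scale)
qed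

text \<open>
  A tensor is the sum of \<open>a \<otimes> slice n a [] G\<close> over the finitely many words \<open>a\<close> that can
  precede the last \<open>n\<close> letters. The indices are natural numbers because this is the form of the
  elements of \<open>quotient_tensor\<close>.
\<close>

lemma TV_tensor_expand:
  assumes "G \<in> TV_tensor n W"
  obtains m :: nat and \<alpha> t where "\<And>i. i < m \<Longrightarrow> \<alpha> i \<in> tensors" "\<And>i. i < m \<Longrightarrow> t i \<in> W"
    "G = (\<Sum>i<m. tmult (\<alpha> i) (t i))"
proof -
  have G: "G \<in> tensors" "\<And>w. G w \<noteq> 0 \<Longrightarrow> n \<le> length w" "\<And>a. slice n a [] G \<in> W"
    using assms by (auto simp: TV_tensor_def deep_def)
  obtain L where L: "\<forall>w. G w \<noteq> 0 \<longrightarrow> length w \<le> L \<and> set w \<subseteq> B"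
    using G(1) unfolding tensors_def by blast
  define F where "F = (\<Union>l\<le>L. words l)"
  have F: "finite F"
    unfolding F_def using finite_words by auto
  obtain h where h: "bij_betw h {..<card F} F"
    using ex_bij_betw_nat_finite[OF F] by (auto simp: atLeast0LessThan)
  have wt: "word_tensor a \<in> homog (length a)" if "a \<in> F" for a
    using that word_tensor_homog[of a "length a"] by (auto simp: F_def words_def)
  have "G = (\<Sum>a\<in>F. tmult (word_tensor a) (slice n a [] G))"
  proof
    fix w
    have "(\<Sum>a\<in>F. tmult (word_tensor a) (slice n a [] G)) w =
        (\<Sum>a\<in>F. if a = take (length w - n) w then (if n \<le> length w then G w else 0) else 0)"
      unfolding sum_fun_apply
    proof (rule sum.cong[OF refl])
      fix a assume a: "a \<in> F"
      show "tmult (word_tensor a) (slice n a [] G) w =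
          (if a = take (length w - n) w then (if n \<le> length w then G w else 0) else 0)"
      proof (cases "length a \<le> length w \<and> take (length a) w = a \<and> length w - length a = n")
        case True
        then show ?thesis
          unfolding tmult_homog_left[OF wt[OF a]]
          by (auto simp: slice_def word_tensor_def)
      next
        case False
        then have "tmult (word_tensor a) (slice n a [] G) w = 0"
          unfolding tmult_homog_left[OF wt[OF a]] by (auto simp: slice_def word_tensor_def)
        moreover have "\<not> (a = take (length w - n) w \<and> n \<le> length w)"
          using False by auto
        ultimately show ?thesis by auto
      qed
    qed
    also have "\<dots> = (if take (length w - n) w \<in> F \<and> n \<le> length w then G w else 0)"
      using F by simp
    also have "\<dots> = G w"
    proof (cases "G w = 0")
      case False
      then have "take (length w - n) w \<in> words (length w - n)" "length w - n \<le> L"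
        using L unfolding words_def by (auto dest: in_set_takeD)
      then show ?thesis
        using G(2)[OF False] unfolding F_def by auto
    qed simp
    finally show "G w = (\<Sum>a\<in>F. tmult (word_tensor a) (slice n a [] G)) w" ..
  qed
  also have "\<dots> = (\<Sum>i<card F. tmult (word_tensor (h i)) (slice n (h i) [] G))"
    by (rule sum.reindex_bij_betw[OF h, symmetric])
  finally have *: "G = (\<Sum>i<card F. tmult (word_tensor (h i)) (slice n (h i) [] G))" .
  have "word_tensor (h i) \<in> tensors" if "i < card F" for i
    using wt[of "h i"] that bij_betwE[OF h] homog_tensors by blast
  then show ?thesis
    using G(3) by (intro that[OF _ _ *]) auto
qed

lemma TV_tensor_iff:
  assumes G: "G \<in> deep n" and W: "tsubspace W" "W \<subseteq> homog n"
  shows "G \<in> TV_tensor n W \<longleftrightarrow> (\<forall>D\<ge>n. degree_part D G \<in> tprod (homog (D - n)) W)"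
proof -
  have sl: "slice n a [] (degree_part D G) = slice n a [] G" if "D = length a + n" for a D
    using that by (auto simp: slice_def degree_part_def fun_eq_iff)
  have "degree_part D G \<in> tprod (homog (D - n)) W \<longleftrightarrow> (\<forall>a. length a = D - n \<longrightarrow> slice n a [] G \<in> W)"
    if "n \<le> D" for D
    using tprod_homog_left[OF W, of "D - n"] degree_part_in_homog[OF subsetD[OF deep_tensors G], of D] that
    by (auto simp: sl)
  then show ?thesis
    using G unfolding TV_tensor_def by auto (metis add_diff_cancel_right' le_add2)
qed

end

context homogeneous_algebra
begin

abbreviation "A \<equiv> quotient_algebra s B R"
abbreviation "cls \<equiv> quotient_class s B R"

sublocale I: ideal I "tensor_algebra s B"
  by (rule ideal_I)

sublocale A: ring A
  unfolding quotient_algebra_def genideal_R by (rule I.quotient_is_ring)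

lemma cls_eq: "cls t = I +>\<^bsub>tensor_algebra s B\<^esub> t"
  unfolding quotient_class_def genideal_R ..

lemma A_eq: "A = tensor_algebra s B Quot I"
  unfolding quotient_algebra_def genideal_R ..

lemma cls_add: "\<lbrakk>t \<in> tensors; u \<in> tensors\<rbrakk> \<Longrightarrow> cls t \<oplus>\<^bsub>A\<^esub> cls u = cls (t + u)"
  using ring_hom_add[OF I.rcos_ring_hom, of t u]
  by (simp add: cls_eq A_eq carrier_tensor_algebra tensor_algebra_simps)

lemma cls_mult: "\<lbrakk>t \<in> tensors; u \<in> tensors\<rbrakk> \<Longrightarrow> cls t \<otimes>\<^bsub>A\<^esub> cls u = cls (tmult t u)"
  using ring_hom_mult[OF I.rcos_ring_hom, of t u]
  by (simp add: cls_eq A_eq carrier_tensor_algebra tensor_algebra_simps)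

lemma carrier_A: "carrier A = cls ` tensors"
  by (auto simp: A_eq FactRing_def A_RCOSETS_def' cls_eq carrier_tensor_algebra)

lemma cls_closed: "t \<in> tensors \<Longrightarrow> cls t \<in> carrier A"
  by (simp add: carrier_A)

lemma cls_explicit: "cls t = {i + t | i. i \<in> I}"
  by (auto simp: cls_eq a_r_coset_def' tensor_algebra_simps)

lemma cls_self: "t \<in> cls t"
  unfolding cls_explicit using T.subspace_0[OF subspace_I] by force

lemma cls_eq_iff: "cls t = cls u \<longleftrightarrow> t - u \<in> I"
proof
  assume "cls t = cls u"
  then have "t \<in> cls u"
    using cls_self by blast
  then show "t - u \<in> I"
    unfolding cls_explicit by auto
next
  assume d: "t - u \<in> I"
  have "i + t \<in> cls u" "i + u \<in> cls t" if "i \<in> I" for i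
  proof -
    have "i + (t - u) \<in> I" "i - (t - u) \<in> I"
      using that d subspace_I by (auto intro: T.subspace_add T.subspace_diff)
    moreover have "i + t = i + (t - u) + u" "i + u = i - (t - u) + t"
      by simp_all
    ultimately show "i + t \<in> cls u" "i + u \<in> cls t"
      unfolding cls_explicit by blast+
  qed
  then show "cls t = cls u"
    by (auto simp: cls_explicit[of t] cls_explicit[of u])
qed

lemma zero_A: "\<zero>\<^bsub>A\<^esub> = cls 0"
  by (auto simp: A_eq FactRing_def cls_explicit)

lemma cls_eq_zero_iff: "cls t = \<zero>\<^bsub>A\<^esub> \<longleftrightarrow> t \<in> I"
  by (simp add: zero_A cls_eq_iff)

lemma finsum_cls:
  assumes "finite F" "\<And>i. i \<in> F \<Longrightarrow> f i \<in> tensors"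
  shows "(\<Oplus>\<^bsub>A\<^esub>i\<in>F. cls (f i)) = cls (\<Sum>i\<in>F. f i)"
  using assms
proof (induction F rule: finite_induct)
  case empty
  then show ?case by (simp add: zero_A)
next
  case (insert x F)
  have "(\<Sum>i\<in>F. f i) \<in> tensors"
    using insert by (intro T.subspace_sum subspace_tensors) auto
  then show ?case
    using insert by (subst A.finsum_insert) (auto simp: cls_add cls_closed)
qed

lemma scale_cls:
  assumes "t \<in> tensors"
  shows "quotient_scale s B R c (cls t) = cls (tscale c t)"
proof -
  have "tscale c tone \<in> tensors"
    using tone_homog homog_tensors subspace_tensors by (auto intro!: T.subspace_scale)
  then show ?thesis
    unfolding quotient_scale_def using assms
    by (simp add: cls_mult tmult_scale_left tmult_tone_left)
qed

lemma augmentation_cls: "augmentation (cls t) = t []"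
proof -
  have "i [] = 0" if "i \<in> I" for i
  proof -
    have "degree_part 0 i \<in> T.fjoin (X 0) {}"
      using that N unfolding I_def by (auto dest: spec[of _ 0])
    then have "degree_part 0 i = 0"
      by (simp add: T.fjoin_def)
    then show ?thesis
      by (auto simp: degree_part_def fun_eq_iff tensor_apply dest: spec[of _ "[]"])
  qed
  then have "x [] = t []" if "x \<in> cls t" for x
    using that unfolding cls_explicit by (auto simp: tensor_apply)
  then have "(\<lambda>t. t []) ` cls t = {t []}"
    using cls_self[of t] by blast
  then show ?thesis
    by (simp add: augmentation_def)
qed

text \<open>
  The element of \<open>A \<otimes> V\<^bsup>\<otimes>n\<^esup>\<close> represented by \<open>G \<in> TV \<otimes> V\<^bsup>\<otimes>n\<^esup>\<close>.
\<close>

definition lift :: "nat \<Rightarrow> ('v, 'k) tensor \<Rightarrow> 'v list \<Rightarrow> ('v, 'k) tensor set" where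
  "lift n G = (\<lambda>w. if length w = n then cls (tail w G) else \<zero>\<^bsub>A\<^esub>)"

lemma lift_eq_iff: "lift n G = lift n H \<longleftrightarrow> (\<forall>w. length w = n \<longrightarrow> tail w (G - H) \<in> I)"
  unfolding lift_def tail_diff cls_eq_iff[symmetric] by (auto simp: fun_eq_iff)

lemma lift_eq_zero_iff: "lift n G = (\<lambda>w. \<zero>\<^bsub>A\<^esub>) \<longleftrightarrow> (\<forall>w. length w = n \<longrightarrow> tail w G \<in> I)"
  unfolding lift_def cls_eq_zero_iff[symmetric] by (auto simp: fun_eq_iff)

text \<open>
  The kernel of \<open>TV \<otimes> V\<^bsup>\<otimes>n\<^esup> \<rightarrow> A \<otimes> V\<^bsup>\<otimes>n\<^esup>\<close> is \<open>(R) \<otimes> V\<^bsup>\<otimes>n\<^esup>\<close>; in degree \<open>D\<close>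
  this is the sum of those copies of \<open>R\<close> that end before the last \<open>n\<close> factors.
\<close>

lemma tail_in_I_iff:
  assumes "G \<in> deep n"
  shows "(\<forall>w. length w = n \<longrightarrow> tail w G \<in> I) \<longleftrightarrow>
    (\<forall>D\<ge>n. degree_part D G \<in> T.fjoin (X D) {1..D - n + 1 - N})"
proof -
  have G: "G \<in> tensors" using assms deep_tensors by blast
  have sub: "{1..m + 1 - N} \<subseteq> {1..m + 1 - N}" for m by simp
  have *: "degree_part (m + n) G \<in> T.fjoin (X (m + n)) {1..m + 1 - N} \<longleftrightarrow>
      (\<forall>w. length w = n \<longrightarrow> degree_part m (tail w G) \<in> T.fjoin (X m) {1..m + 1 - N})" for m
    unfolding tprod_fjoin_right[symmetric] degree_part_tail
    using tprod_homog_right[OF T.subspace_fjoin fjoin_homog[OF sub], of m n] degree_part_in_homog[OF G] by auto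
  have "(\<forall>w. length w = n \<longrightarrow> tail w G \<in> I) \<longleftrightarrow>
    (\<forall>m w. length w = n \<longrightarrow> degree_part m (tail w G) \<in> T.fjoin (X m) {1..m + 1 - N})"
    using tail_tensors[OF G] unfolding I_def by auto
  also have "\<dots> \<longleftrightarrow> (\<forall>m. degree_part (m + n) G \<in> T.fjoin (X (m + n)) {1..m + 1 - N})"
    using * by blast
  also have "\<dots> \<longleftrightarrow> (\<forall>D\<ge>n. degree_part D G \<in> T.fjoin (X D) {1..D - n + 1 - N})"
    by (metis add_diff_cancel_right' le_add2 le_add_diff_inverse2)
  finally show ?thesis .
qed

lemma finsum_scale_eq_lift:
  fixes m :: nat
  assumes "\<And>i. i < m \<Longrightarrow> \<alpha> i \<in> tensors" "\<And>i. i < m \<Longrightarrow> t i \<in> homog n"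
  shows "(\<lambda>w. \<Oplus>\<^bsub>A\<^esub>i\<in>{..<m}. quotient_scale s B R (t i w) (cls (\<alpha> i))) =
    lift n (\<Sum>i<m. tmult (\<alpha> i) (t i))"
proof
  fix w
  have "(\<Oplus>\<^bsub>A\<^esub>i\<in>{..<m}. quotient_scale s B R (t i w) (cls (\<alpha> i))) =
      (\<Oplus>\<^bsub>A\<^esub>i\<in>{..<m}. cls (tscale (t i w) (\<alpha> i)))"
    using assms(1) by (intro A.add.finprod_cong) (auto simp: scale_cls cls_closed T.subspace_scale[OF subspace_tensors])
  also have "\<dots> = cls (\<Sum>i<m. tscale (t i w) (\<alpha> i))"
    using assms(1) by (intro finsum_cls) (auto simp: T.subspace_scale[OF subspace_tensors])
  also have "\<dots> = lift n (\<Sum>i<m. tmult (\<alpha> i) (t i)) w"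
  proof (cases "length w = n")
    case True
    have "tail w (\<Sum>i<m. tmult (\<alpha> i) (t i)) = (\<Sum>i<m. tscale (t i w) (\<alpha> i))"
    proof
      fix u
      show "tail w (\<Sum>i<m. tmult (\<alpha> i) (t i)) u = (\<Sum>i<m. tscale (t i w) (\<alpha> i)) u"
        unfolding tail_def sum_fun_apply using True
        by (intro sum.cong refl) (simp add: tmult_homog_right[OF assms(2)] tscale_apply)
    qed
    then show ?thesis
      using True by (simp add: lift_def)
  next
    case False
    then have "t i w = 0" if "i < m" for i
      using homogD[OF assms(2)[OF that], of w] by blast
    then show ?thesis
      using False by (simp add: lift_def zero_A)
  qed
  finally show "(\<Oplus>\<^bsub>A\<^esub>i\<in>{..<m}. quotient_scale s B R (t i w) (cls (\<alpha> i))) =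
    lift n (\<Sum>i<m. tmult (\<alpha> i) (t i)) w" .
qed

lemma quotient_tensor_eq:
  assumes W: "tsubspace W" "W \<subseteq> homog n"
  shows "quotient_tensor s B R W = lift n ` TV_tensor n W"
proof
  show "quotient_tensor s B R W \<subseteq> lift n ` TV_tensor n W"
  proof
    fix F assume "F \<in> quotient_tensor s B R W"
    then obtain m :: nat and a t where at: "\<And>i. i < m \<Longrightarrow> a i \<in> carrier A \<and> t i \<in> W"
      and F: "F = (\<lambda>w. \<Oplus>\<^bsub>A\<^esub>i\<in>{..<m}. quotient_scale s B R (t i w) (a i))"
      unfolding quotient_tensor_def by blast
    have "\<forall>i. \<exists>\<alpha>. i < m \<longrightarrow> \<alpha> \<in> tensors \<and> a i = cls \<alpha>"
      using at unfolding carrier_A by blast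
    then obtain \<alpha> where \<alpha>: "\<And>i. i < m \<Longrightarrow> \<alpha> i \<in> tensors \<and> a i = cls (\<alpha> i)"
      by metis
    have "F = (\<lambda>w. \<Oplus>\<^bsub>A\<^esub>i\<in>{..<m}. quotient_scale s B R (t i w) (cls (\<alpha> i)))"
      unfolding F
      using \<alpha> by (intro ext A.finsum_cong')
        (auto simp: scale_cls cls_closed T.subspace_scale[OF subspace_tensors])
    also have "\<dots> = lift n (\<Sum>i<m. tmult (\<alpha> i) (t i))"
      using \<alpha> at W by (intro finsum_scale_eq_lift) auto
    finally show "F \<in> lift n ` TV_tensor n W"
      using \<alpha> at W tmult_TV_tensor
      by (auto intro!: imageI T.subspace_sum subspace_TV_tensor)
  qed
  show "lift n ` TV_tensor n W \<subseteq> quotient_tensor s B R W"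
  proof
    fix F assume "F \<in> lift n ` TV_tensor n W"
    then obtain G where G: "G \<in> TV_tensor n W" "F = lift n G"
      by blast
    obtain m :: nat and \<alpha> t where at: "\<And>i. i < m \<Longrightarrow> \<alpha> i \<in> tensors" "\<And>i. i < m \<Longrightarrow> t i \<in> W"
      and G': "G = (\<Sum>i<m. tmult (\<alpha> i) (t i))"
      using TV_tensor_expand[OF G(1)] by blast
    have F: "F = (\<lambda>w. \<Oplus>\<^bsub>A\<^esub>i\<in>{..<m}. quotient_scale s B R (t i w) (cls (\<alpha> i)))"
      unfolding G(2) G' using at W by (intro finsum_scale_eq_lift[symmetric]) auto
    show "F \<in> quotient_tensor s B R W"
      unfolding quotient_tensor_def mem_Collect_eq
      by (rule exI[of _ m], rule exI[of _ "\<lambda>i. cls (\<alpha> i)"], rule exI[of _ t])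
        (use at cls_closed F in simp)
  qed
qed

text \<open>
  On representatives the differential is the identity: multiplying the coefficient of \<open>b u\<close> by
  the letter \<open>b\<close> and summing over \<open>b\<close> collects all words that end in \<open>u\<close>. A word that consists of
  \<open>u\<close> alone would be lost, but \<open>G\<close> has no component of degree \<open>n\<close>.
\<close>

lemma koszul_diff_lift:
  assumes G: "G \<in> deep (Suc n)"
  shows "koszul_diff s B R (lift (Suc n) G) = lift n G"
proof
  have GT: "G \<in> tensors" using G deep_tensors by blast
  have wb: "word_tensor [b] \<in> homog 1" if "b \<in> B" for b
    using that word_tensor_homog[of "[b]" 1] by (auto simp: words_def)
  have wt: "word_tensor [b] \<in> tensors" if "b \<in> B" for b
    using wb[OF that] homog_tensors by blast
  fix u
  show "koszul_diff s B R (lift (Suc n) G) u = lift n G u"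
  proof (cases "length u = n")
    case True
    have "koszul_diff s B R (lift (Suc n) G) u =
        (\<Oplus>\<^bsub>A\<^esub>b\<in>B. cls (tmult (tail (b # u) G) (word_tensor [b])))"
      unfolding koszul_diff_def using True tail_tensors[OF GT] wt
      by (intro A.add.finprod_cong) (auto simp: lift_def vec_basis cls_mult cls_closed tmult_tensors)
    also have "\<dots> = cls (\<Sum>b\<in>B. tmult (tail (b # u) G) (word_tensor [b]))"
      using tail_tensors[OF GT] wt by (intro finsum_cls V.finite_Basis tmult_tensors)
    also have "(\<Sum>b\<in>B. tmult (tail (b # u) G) (word_tensor [b])) = tail u G"
    proof
      fix x
      show "(\<Sum>b\<in>B. tmult (tail (b # u) G) (word_tensor [b])) x = tail u G x"
      proof (cases x rule: rev_cases)
        case Nil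
        have "G u = 0"
          using G True unfolding deep_def by fastforce
        then show ?thesis
          using Nil by (simp add: sum_fun_apply tmult_homog_right[OF wb] tail_def)
      next
        case (snoc y c)
        have "(\<Sum>b\<in>B. tmult (tail (b # u) G) (word_tensor [b])) x =
            (\<Sum>b\<in>B. if b = c then G (x @ u) else 0)"
          unfolding sum_fun_apply
        proof (rule sum.cong[OF refl])
          fix b assume "b \<in> B"
          then show "tmult (tail (b # u) G) (word_tensor [b]) x = (if b = c then G (x @ u) else 0)"
            unfolding tmult_homog_right[OF wb[OF \<open>b \<in> B\<close>]]
            by (auto simp: tail_def snoc word_tensor_def)
        qed
        also have "\<dots> = (if c \<in> B then G (x @ u) else 0)"
          using V.finite_Basis by simp
        also have "\<dots> = tail u G x"
          using GT snoc unfolding tensors_def tail_def by force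
        finally show ?thesis .
      qed
    qed
    finally show ?thesis
      using True by (simp add: lift_def)
  next
    case False
    have "koszul_diff s B R (lift (Suc n) G) u = (\<Oplus>\<^bsub>A\<^esub>b\<in>B. \<zero>\<^bsub>A\<^esub>)"
      unfolding koszul_diff_def using False wt
      by (intro A.add.finprod_cong) (auto simp: lift_def vec_basis cls_closed)
    then show ?thesis
      using False by (simp add: lift_def)
  qed
qed

lemma koszul_diff_pow_lift:
  assumes "G \<in> deep (n + e)"
  shows "(koszul_diff s B R ^^ e) (lift (n + e) G) = lift n G"
  using assms
proof (induction e)
  case 0
  then show ?case by simp
next
  case (Suc e)
  then have "G \<in> deep (n + e)"
    using deep_antimono[of "n + e" "n + Suc e"] by auto
  then show ?case
    using Suc koszul_diff_lift[of G "n + e"]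
    by (simp only: funpow_Suc_right comp_apply add_Suc_right)
qed

text \<open>
  \<open>VJ n D\<close> is \<open>V\<^bsup>\<otimes>D-n\<^esup> \<otimes> J\<^sub>n\<close> (\<open>tprod_homog_J\<close>), and \<open>IV m D\<close> is the sum of the
  copies of \<open>R\<close> that lie within the first \<open>m\<close> factors of \<open>V\<^bsup>\<otimes>D\<^esup>\<close>, that is
  \<open>(R)\<^sub>m \<otimes> V\<^bsup>\<otimes>D-m\<^esup>\<close>. For \<open>n \<le> D\<close> and \<open>n < N\<close> the interval in the first definition
  is empty, in accordance with \<open>J\<^sub>n = V\<^bsup>\<otimes>n\<^esup>\<close>.
\<close>

definition VJ :: "nat \<Rightarrow> nat \<Rightarrow> ('v, 'k) tensor set" where
  "VJ n D = T.fmeet (homog D) (X D) {D + 1 - n..D + 1 - N}"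

definition IV :: "nat \<Rightarrow> nat \<Rightarrow> ('v, 'k) tensor set" where
  "IV m D = T.fjoin (X D) {1..m + 1 - N}"

lemma subspace_X: "tsubspace (X D i)"
  by (rule subspace_place)

lemma subspace_IV: "tsubspace (IV m D)"
  unfolding IV_def by (rule T.subspace_fjoin)

lemma subspace_VJ: "tsubspace (VJ n D)"
  unfolding VJ_def by (intro T.subspace_fmeet subspace_homog subspace_X)

lemma VJ_homog: "VJ n D \<subseteq> homog D"
  unfolding VJ_def T.fmeet_def by auto

lemma subspace_J: "tsubspace (J s B N R n)"
  unfolding J_def by (auto simp: Vpow_eq subspace_homog subspace_X intro!: T.subspace_Int)

lemma J_homog: "J s B N R n \<subseteq> homog n"
proof (cases "n < N")
  case False
  then have "J s B N R n \<subseteq> X n 1"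
    unfolding J_def by (auto dest: bspec[of _ _ 1])
  then show ?thesis
    using place_homog[OF subspace_R R_homog, of 1 n] False by (simp add: Suc_diff_le)
qed (simp add: J_def Vpow_eq)

lemma tprod_homog_J: "tprod (homog m) (J s B N R n) = VJ n (m + n)"
proof (cases "n < N")
  case True
  then show ?thesis
    by (simp add: J_def Vpow_eq tprod_homog VJ_def T.fmeet_def)
next
  case False
  let ?P = "{1..n + 1 - N}"
  have J: "J s B N R n = (\<Inter>i\<in>?P. X n i)"
    using False by (simp add: J_def)
  have "tprod (homog m) (J s B N R n) = {t \<in> homog (m + n). \<forall>i\<in>?P. t \<in> tprod (homog m) (X n i)}"
    unfolding tprod_homog_left[OF subspace_J J_homog]
    using tprod_homog_left[OF subspace_X place_homog[OF subspace_R R_homog], of _ n m]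
    by (auto simp: J)
  also have "\<dots> = {t \<in> homog (m + n). \<forall>i\<in>?P. t \<in> X (m + n) (m + i)}"
    using tprod_place_left[OF subspace_R R_homog] by auto
  also have "\<dots> = homog (m + n) \<inter> (\<Inter>i\<in>(+) m ` ?P. X (m + n) i)"
    by (simp only: image_image) auto
  also have "(+) m ` ?P = {m + n + 1 - n..m + n + 1 - N}"
    using False by (simp add: image_add_atLeastAtMost add.commute)
  finally show ?thesis
    unfolding VJ_def T.fmeet_def by simp
qed

lemma TV_tensor_J_iff:
  assumes "G \<in> deep n"
  shows "G \<in> TV_tensor n (J s B N R n) \<longleftrightarrow> (\<forall>D\<ge>n. degree_part D G \<in> VJ n D)"
  using TV_tensor_iff[OF assms subspace_J J_homog] by (simp add: tprod_homog_J)

lemma TV_tensor_deep: "TV_tensor n W \<subseteq> deep n"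
  unfolding TV_tensor_def by auto

abbreviation "deg \<equiv> koszul_degree N"

lemma deg_Suc: "deg (Suc j) = deg j + (if even j then 1 else N - 1)"
  using N by (intro koszul_degree_Suc) simp

lemma koszul_term_eq: "koszul_term s B N R j = lift (deg j) ` TV_tensor (deg j) (J s B N R (deg j))"
  unfolding koszul_term_def by (rule quotient_tensor_eq[OF subspace_J J_homog])

lemma koszul_map_lift: "G \<in> deep (deg (Suc j)) \<Longrightarrow> koszul_map s B N R j (lift (deg (Suc j)) G) = lift (deg j) G"
  unfolding koszul_map_def deg_Suc by (rule koszul_diff_pow_lift)

lemma lift_zero_iff_IV:
  "G \<in> deep n \<Longrightarrow> lift n G = (\<lambda>w. \<zero>\<^bsub>A\<^esub>) \<longleftrightarrow> (\<forall>D\<ge>n. degree_part D G \<in> IV (D - n) D)"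
  unfolding lift_eq_zero_iff IV_def by (rule tail_in_I_iff)

lemma lift_eq_iff_IV:
  assumes "G \<in> deep n" "H \<in> deep n"
  shows "lift n G = lift n H \<longleftrightarrow> (\<forall>D\<ge>n. degree_part D G - degree_part D H \<in> IV (D - n) D)"
proof -
  have "G - H \<in> deep n"
    using assms subspace_deep by (intro T.subspace_diff)
  then show ?thesis
    using tail_in_I_iff[of "G - H" n] unfolding lift_eq_iff IV_def degree_part_diff by simp
qed

text \<open>
  At the end of the complex exactness holds for all relations: both sides are represented by
  the tensors without constant term.
\<close>

lemma exact_at_0:
  "{F \<in> koszul_term s B N R 0. augmentation (F []) = 0} = koszul_map s B N R 0 ` koszul_term s B N R 1"
proof -
  have J0: "J s B N R 0 = homog 0" "J s B N R 1 = homog 1"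
    using N unfolding J_def Vpow_eq by auto
  have tt: "TV_tensor n (homog n) = deep n" for n
  proof -
    have "degree_part D G \<in> tprod (homog (D - n)) (homog n)" if "G \<in> deep n" "n \<le> D" for G D
      using degree_part_in_homog[OF subsetD[OF deep_tensors that(1)], of D] that(2) by (simp add: tprod_homog)
    then show ?thesis
      using TV_tensor_iff[OF _ subspace_homog order_refl, of _ n] TV_tensor_deep by blast
  qed
  have aug: "augmentation (lift 0 G []) = G []" for G
    by (simp add: lift_def augmentation_cls tail_def)
  have "{F \<in> koszul_term s B N R 0. augmentation (F []) = 0} = lift 0 ` {G \<in> deep 0. G [] = 0}"
    unfolding koszul_term_eq by (auto simp: J0 tt aug)
  also have "{G \<in> deep 0. G [] = 0} = deep 1"
    unfolding deep_def by (auto simp: Suc_le_eq)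
  also have "lift 0 ` deep 1 = koszul_map s B N R 0 ` koszul_term s B N R 1"
    unfolding koszul_term_eq image_image using koszul_map_lift[of _ 0]
    by (intro image_cong) (auto simp: J0[unfolded One_nat_def] tt[of "Suc 0"])
  finally show ?thesis .
qed

text \<open>
  Exactness at \<open>A \<otimes> J\<^sub>n\<close> in total degree \<open>D\<close>, where \<open>n = deg (Suc j)\<close>: a tensor in
  \<open>V\<^bsup>\<otimes>D-n\<^esup> \<otimes> J\<^sub>n\<close> that the outgoing map sends to zero is the sum of a
  tensor in the source of the incoming map and of one that represents zero. For \<open>D\<close> below the
  degree of the source there is nothing to demand, since then the outgoing map is injective on
  representatives.
\<close>

definition graded_exact :: bool where
  "graded_exact \<longleftrightarrow> (\<forall>j D. deg (Suc (Suc j)) \<le> D \<longrightarrow>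
    VJ (deg (Suc j)) D \<inter> IV (D - deg j) D \<subseteq> VJ (deg (Suc (Suc j))) D + IV (D - deg (Suc j)) D)"

lemma deg_less: "deg j < deg (Suc j)"
  using N by (simp add: deg_Suc)

lemma VJ_antimono: "n \<le> n' \<Longrightarrow> VJ n' D \<subseteq> VJ n D"
  unfolding VJ_def by (intro T.fmeet_antimono) auto

text \<open>
  The composition of two consecutive maps is zero because \<open>J\<^bsub>n+N\<^esub> \<subseteq> R \<otimes> V\<^bsup>\<otimes>n\<^esup>\<close>.
\<close>

lemma VJ_subset_IV:
  assumes "deg (Suc (Suc j)) \<le> D"
  shows "VJ (deg (Suc (Suc j))) D \<subseteq> IV (D - deg j) D"
proof -
  have n: "deg (Suc (Suc j)) = deg j + N"
    by (rule koszul_degree_step)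
  define i where "i = D + 1 - deg (Suc (Suc j))"
  have i: "i \<in> {D + 1 - deg (Suc (Suc j))..D + 1 - N}" "i \<in> {1..D - deg j + 1 - N}"
    using assms unfolding i_def n by auto
  have "VJ (deg (Suc (Suc j))) D \<subseteq> X D i"
    unfolding VJ_def T.fmeet_def using i(1) by auto
  also have "X D i \<subseteq> IV (D - deg j) D"
    unfolding IV_def T.fjoin_def using i(2) by (intro order_trans[OF _ T.span_superset]) auto
  finally show ?thesis .
qed

text \<open>
  All subspaces involved are graded, so an element of the kernel may be treated one degree at a
  time; the preimages found in the single degrees are added up.
\<close>

lemma N_koszul_iff: "N_koszul s B N R \<longleftrightarrow> graded_exact"
proof
  assume K: "N_koszul s B N R"
  show graded_exact
    unfolding graded_exact_def
  proof (intro allI impI subsetI)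
    fix j D x
    assume D: "deg (Suc (Suc j)) \<le> D" and x: "x \<in> VJ (deg (Suc j)) D \<inter> IV (D - deg j) D"
    have le: "deg j \<le> D" "deg (Suc j) \<le> D"
      using D deg_less[of j] deg_less[of "Suc j"] by auto
    have xh: "x \<in> homog D" using x VJ_homog by auto
    have deep: "x \<in> deep (deg j)" "x \<in> deep (deg (Suc j))"
      using xh homog_deep le by blast+
    have comp: "degree_part E x = (if E = D then x else 0)" for E
      by (rule degree_part_homog[OF xh])
    have "x \<in> TV_tensor (deg (Suc j)) (J s B N R (deg (Suc j)))"
      using x T.subspace_0[OF subspace_VJ] by (simp add: TV_tensor_J_iff[OF deep(2)] comp)
    moreover have "lift (deg j) x = (\<lambda>w. \<zero>\<^bsub>A\<^esub>)"
      using x T.subspace_0[OF subspace_IV] by (simp add: lift_zero_iff_IV[OF deep(1)] comp)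
    ultimately have "lift (deg (Suc j)) x \<in> {F \<in> koszul_term s B N R (Suc j).
        koszul_map s B N R j F = (\<lambda>w. \<zero>\<^bsub>A\<^esub>)}"
      by (simp add: koszul_term_eq koszul_map_lift[OF deep(2)])
    then have "lift (deg (Suc j)) x \<in> koszul_map s B N R (Suc j) ` koszul_term s B N R (Suc (Suc j))"
      using K unfolding N_koszul_def by blast
    then obtain H where H: "H \<in> TV_tensor (deg (Suc (Suc j))) (J s B N R (deg (Suc (Suc j))))"
      and eq: "lift (deg (Suc j)) x = koszul_map s B N R (Suc j) (lift (deg (Suc (Suc j))) H)"
      unfolding koszul_term_eq by blast
    have Hd: "H \<in> deep (deg (Suc (Suc j)))"
      using H TV_tensor_deep by blast
    then have Hd1: "H \<in> deep (deg (Suc j))"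
      using deep_antimono deg_less by (meson less_imp_le subsetD)
    have "degree_part D x - degree_part D H \<in> IV (D - deg (Suc j)) D"
      using eq le by (simp add: koszul_map_lift[OF Hd] lift_eq_iff_IV[OF deep(2) Hd1])
    moreover have "degree_part D H \<in> VJ (deg (Suc (Suc j))) D"
      using H D TV_tensor_J_iff[OF Hd] by blast
    ultimately have "degree_part D H + (degree_part D x - degree_part D H) \<in>
        VJ (deg (Suc (Suc j))) D + IV (D - deg (Suc j)) D"
      by (intro set_plus_intro)
    then show "x \<in> VJ (deg (Suc (Suc j))) D + IV (D - deg (Suc j)) D"
      by (simp add: comp)
  qed
next
  assume E: graded_exact
  have "{F \<in> koszul_term s B N R (Suc j). koszul_map s B N R j F = (\<lambda>w. \<zero>\<^bsub>A\<^esub>)} =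
      koszul_map s B N R (Suc j) ` koszul_term s B N R (Suc (Suc j))" (is "?K = ?I") for j
  proof
    show "?I \<subseteq> ?K"
    proof
      fix F assume "F \<in> ?I"
      then obtain H where H: "H \<in> TV_tensor (deg (Suc (Suc j))) (J s B N R (deg (Suc (Suc j))))"
        and eq: "F = koszul_map s B N R (Suc j) (lift (deg (Suc (Suc j))) H)"
        unfolding koszul_term_eq by blast
      have Hd: "H \<in> deep (deg (Suc (Suc j)))"
        using H TV_tensor_deep by blast
      then have Hd1: "H \<in> deep (deg (Suc j))" "H \<in> deep (deg j)"
        using deep_antimono deg_less by (meson less_imp_le subsetD order_trans)+
      have F: "F = lift (deg (Suc j)) H"
        using eq koszul_map_lift[OF Hd] by simp
      have cH: "degree_part D H \<in> VJ (deg (Suc j)) D \<and> degree_part D H \<in> IV (D - deg j) D" for D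
      proof (cases "deg (Suc (Suc j)) \<le> D")
        case True
        then have "degree_part D H \<in> VJ (deg (Suc (Suc j))) D"
          using H TV_tensor_J_iff[OF Hd] by blast
        then show ?thesis
          using VJ_antimono[OF less_imp_le[OF deg_less[of "Suc j"]]] VJ_subset_IV[OF True] by blast
      next
        case False
        then have "degree_part D H = 0"
          using Hd by (simp add: deep_iff)
        then show ?thesis
          using T.subspace_0[OF subspace_VJ] T.subspace_0[OF subspace_IV] by simp
      qed
      have "H \<in> TV_tensor (deg (Suc j)) (J s B N R (deg (Suc j)))"
        using cH by (simp add: TV_tensor_J_iff[OF Hd1(1)])
      moreover have "lift (deg j) H = (\<lambda>w. \<zero>\<^bsub>A\<^esub>)"
        using cH by (simp add: lift_zero_iff_IV[OF Hd1(2)])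
      ultimately show "F \<in> ?K"
        by (simp add: F koszul_term_eq koszul_map_lift[OF Hd1(1)])
    qed
    show "?K \<subseteq> ?I"
    proof
      fix F assume "F \<in> ?K"
      then obtain G where G: "G \<in> TV_tensor (deg (Suc j)) (J s B N R (deg (Suc j)))"
        and F: "F = lift (deg (Suc j)) G" and z: "koszul_map s B N R j F = (\<lambda>w. \<zero>\<^bsub>A\<^esub>)"
        unfolding koszul_term_eq by blast
      have Gd: "G \<in> deep (deg (Suc j))"
        using G TV_tensor_deep by blast
      then have Gd0: "G \<in> deep (deg j)"
        using deep_antimono deg_less by (meson less_imp_le subsetD)
      have GT: "G \<in> tensors"
        using Gd deep_tensors by blast
      have GZ: "degree_part D G \<in> VJ (deg (Suc j)) D" if "deg (Suc j) \<le> D" for D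
        using G that TV_tensor_J_iff[OF Gd] by blast
      have GS: "degree_part D G \<in> IV (D - deg j) D" if "deg j \<le> D" for D
        using z that koszul_map_lift[OF Gd] lift_zero_iff_IV[OF Gd0] unfolding F by simp
      have ex: "\<exists>h. h \<in> VJ (deg (Suc (Suc j))) D \<and> (D < deg (Suc (Suc j)) \<longrightarrow> h = 0) \<and>
          degree_part D G - h \<in> IV (D - deg (Suc j)) D" if D: "deg (Suc j) \<le> D" for D
      proof (cases "deg (Suc (Suc j)) \<le> D")
        case True
        then have "degree_part D G \<in> VJ (deg (Suc (Suc j))) D + IV (D - deg (Suc j)) D"
          using E GZ[OF D] GS[of D] D deg_less[of j] unfolding graded_exact_def by auto
        then obtain h g where "h \<in> VJ (deg (Suc (Suc j))) D" "g \<in> IV (D - deg (Suc j)) D"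
          "degree_part D G = h + g"
          by (rule set_plus_elim)
        then show ?thesis
          using True by (intro exI[of _ h]) auto
      next
        \<comment> \<open>In degrees below the source of the incoming map there are no relations yet.\<close>
        case False
        have "D - deg j + 1 - N = 0"
          using False N unfolding koszul_degree_step by linarith
        then have "degree_part D G = 0"
          using GS[of D] D deg_less[of j] by (simp add: IV_def T.fjoin_def)
        then show ?thesis
          using T.subspace_0[OF subspace_VJ] T.subspace_0[OF subspace_IV] by (intro exI[of _ 0]) simp
      qed
      have "\<exists>h. h \<in> VJ (deg (Suc (Suc j))) D \<and> (D < deg (Suc (Suc j)) \<longrightarrow> h = 0) \<and>
          (deg (Suc j) \<le> D \<longrightarrow> degree_part D G - h \<in> IV (D - deg (Suc j)) D)" for D
      proof (cases "deg (Suc j) \<le> D")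
        case True
        then show ?thesis using ex[OF True] by blast
      next
        case False
        then show ?thesis
          using T.subspace_0[OF subspace_VJ] by (intro exI[of _ 0]) simp
      qed
      then have "\<forall>D. \<exists>h. h \<in> VJ (deg (Suc (Suc j))) D \<and> (D < deg (Suc (Suc j)) \<longrightarrow> h = 0) \<and>
          (deg (Suc j) \<le> D \<longrightarrow> degree_part D G - h \<in> IV (D - deg (Suc j)) D)"
        by (rule allI)
      then obtain h where h: "\<And>D. h D \<in> VJ (deg (Suc (Suc j))) D"
        "\<And>D. D < deg (Suc (Suc j)) \<Longrightarrow> h D = 0"
        "\<And>D. deg (Suc j) \<le> D \<Longrightarrow> degree_part D G - h D \<in> IV (D - deg (Suc j)) D"
        using choice by (metis (mono_tags, lifting))
      have hh: "h D \<in> homog D" for D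
        using h(1) VJ_homog by blast
      obtain L where L: "\<And>D. D > L \<Longrightarrow> degree_part D G = 0"
        using tensors_expand[OF GT] by blast
      define H where "H = (\<Sum>D\<le>L. h D)"
      have cH: "degree_part D H = (if D \<le> L then h D else 0)" for D
        unfolding H_def by (rule degree_part_sum_homog[OF hh])
      have HT: "H \<in> tensors"
        unfolding H_def using hh homog_tensors by (intro T.subspace_sum subspace_tensors) blast
      have Hd: "H \<in> deep (deg (Suc (Suc j)))"
        using HT h(2) by (simp add: deep_iff cH)
      then have Hd1: "H \<in> deep (deg (Suc j))"
        using deep_antimono deg_less by (meson less_imp_le subsetD)
      have "H \<in> TV_tensor (deg (Suc (Suc j))) (J s B N R (deg (Suc (Suc j))))"
        using h(1) T.subspace_0[OF subspace_VJ] by (simp add: TV_tensor_J_iff[OF Hd] cH)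
      moreover have "F = lift (deg (Suc j)) H"
        using h(3) L T.subspace_0[OF subspace_IV] unfolding F
        by (auto simp: lift_eq_iff_IV[OF Gd Hd1] cH)
      ultimately show "F \<in> ?I"
        unfolding koszul_term_eq using koszul_map_lift[OF Hd] by (metis image_eqI)
    qed
  qed
  then show "N_koszul s B N R"
    unfolding N_koszul_def using exact_at_0 by (intro conjI allI)
qed

end

section \<open>Koszul algebras are distributive\<close>

lemma koszul_degree_2: "koszul_degree 2 j = j"
  by (simp add: koszul_degree_def)

context tensor_setting
begin

text \<open>
  Backelin's theorem. Exactness at \<open>A \<otimes> J\<^bsub>p+1\<^esub>\<close> in degree \<open>D = m + p + 1\<close> shows that the
  meet over \<open>T = {m+1, \<dots>, D-1}\<close> and the join over \<open>{1, \<dots>, m}\<close> intersect in the meet over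
  \<open>{m, \<dots>, D-1}\<close> plus the intersection of the meet over \<open>T\<close> with the join over
  \<open>{1, \<dots>, m-1}\<close>. This intersection avoids the index \<open>m\<close>, so it can be computed in the
  distributive family without \<open>m\<close>.
\<close>

lemma koszul_imp_distributive_family:
  assumes "tsubspace R" "R \<subseteq> homog 2" "N_koszul s B 2 R"
  shows "T.distributive_family (homog D) {1..D - 1} (place s B 2 R D)"
proof (induction D rule: less_induct)
  case (less D)
  interpret Q: homogeneous_algebra s B 2 R
    using assms by unfold_locales auto
  let ?X = "place s B 2 R"
  let ?S = "{1..D - 1}"
  have proper: "T.distributive_family (homog D) (?S - {k}) (?X D)" if k: "k \<in> ?S" for k
  proof -
    have kD: "k < D" "D - k < D" "k + (D - k) = D"
      using k by auto
    obtain \<beta> where \<beta>: "T.independent \<beta>" "tspan \<beta> = homog D"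
      and l: "\<And>i. i \<in> {1..k - 1} \<Longrightarrow> tprod (?X k i) (homog (D - k)) \<in> T.coordinate_subspaces \<beta>"
      and r: "\<And>i. i \<in> {1..D - k - 1} \<Longrightarrow> tprod (homog k) (?X (D - k) i) \<in> T.coordinate_subspaces \<beta>"
      using distributive_family_tprod[OF less.IH[OF kD(1)] less.IH[OF kD(2)]] kD(3) by auto
    have "?X D i \<in> T.coordinate_subspaces \<beta>" if i: "i \<in> ?S - {k}" for i
    proof (cases "i < k")
      case True
      then show ?thesis
        using l[of i] tprod_place_right[OF assms(1,2), of i k "D - k"] i kD by simp
    next
      case False
      then have "i - k \<in> {1..D - k - 1}" "k + (i - k) = i" "i - k \<in> {1..D - k + 1 - 2}"
        using i by auto
      then show ?thesis
        using r[of "i - k"] tprod_place_left[OF assms(1,2), of "i - k" "D - k" k] kD by simp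
    qed
    then show ?thesis
      unfolding T.distributive_family_def using \<beta> by blast
  qed
  show ?case
  proof (rule T.distributive_family_if_layers)
    show "?X D i \<subseteq> homog D" if "i \<in> ?S" for i
      using place_homog[OF assms(1,2), of i D] that by auto
    fix p assume p: "p \<le> card ?S"
    show "\<exists>T\<subseteq>?S. card T = p \<and> T.fmeet (homog D) (?X D) T \<inter> T.fjoin (?X D) (?S - T)
        \<subseteq> T.fjoin (\<lambda>i. T.fmeet (homog D) (?X D) (insert i T)) (?S - T)"
    proof (cases "p = card ?S")
      case True
      then show ?thesis
        by (intro exI[of _ ?S]) (simp add: T.fjoin_def)
    next
      case False
      define m where "m = D - 1 - p"
      define T where "T = {m + 1..D - 1}"
      have m: "1 \<le> m" "p + 1 + m = D"
        using False p unfolding m_def by auto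
      have ST: "?S - T = {1..m}" and T: "T \<subseteq> ?S" "card T = p"
        using m unfolding T_def by auto
      let ?M = "\<lambda>T. T.fmeet (homog D) (?X D) T"
      have "?M T \<inter> T.fjoin (?X D) {1..m} \<subseteq> ?M (insert m T) + T.fjoin (?X D) {1..m - 1}"
      proof -
        have "Q.graded_exact"
          using assms(3) Q.N_koszul_iff by simp
        then have "Q.VJ (Suc p) D \<inter> Q.IV (D - p) D \<subseteq> Q.VJ (Suc (Suc p)) D + Q.IV (D - Suc p) D"
          using m unfolding Q.graded_exact_def koszul_degree_2 by auto
        moreover have "Q.VJ (Suc p) D = ?M T" "Q.IV (D - p) D = T.fjoin (?X D) {1..m}"
          "Q.IV (D - Suc p) D = T.fjoin (?X D) {1..m - 1}"
          using m unfolding Q.VJ_def Q.IV_def T_def by auto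
        moreover have "{D + 1 - Suc (Suc p)..D + 1 - 2} = insert m T"
          using m unfolding T_def by auto
        then have "Q.VJ (Suc (Suc p)) D = ?M (insert m T)"
          unfolding Q.VJ_def by simp
        ultimately show ?thesis by simp
      qed
      have "?M T \<inter> T.fjoin (?X D) {1..m} \<subseteq> T.fjoin (\<lambda>i. ?M (insert i T)) {1..m}"
      proof
        fix x assume x: "x \<in> ?M T \<inter> T.fjoin (?X D) {1..m}"
        then obtain h g where hg: "h \<in> ?M (insert m T)" "g \<in> T.fjoin (?X D) {1..m - 1}" "x = h + g"
          using \<open>?M T \<inter> _ \<subseteq> _\<close> by (blast elim: set_plus_elim)
        have "h \<in> ?M T"
          using hg(1) T.fmeet_antimono[of T "insert m T"] by blast
        moreover have "tsubspace (?M T)"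
          by (intro T.subspace_fmeet subspace_homog subspace_place)
        ultimately have "x - h \<in> ?M T"
          using x by (intro T.subspace_diff) auto
        then have "g \<in> ?M T \<inter> T.fjoin (?X D) {1..m - 1}"
          using hg by simp
        also have "\<dots> = T.fjoin (\<lambda>i. ?M (insert i T)) {1..m - 1}"
          using m by (intro T.distributive_family_meet_join[OF proper[of m]]) (auto simp: T_def)
        also have "\<dots> \<subseteq> T.fjoin (\<lambda>i. ?M (insert i T)) {1..m}"
          by (intro T.fjoin_mono) auto
        finally have "g \<in> T.fjoin (\<lambda>i. ?M (insert i T)) {1..m}" .
        moreover have "h \<in> T.fjoin (\<lambda>i. ?M (insert i T)) {1..m}"
          unfolding T.fjoin_def using hg(1) m by (intro T.span_base) auto
        ultimately show "x \<in> T.fjoin (\<lambda>i. ?M (insert i T)) {1..m}"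
          unfolding hg(3) by (intro T.subspace_add[OF T.subspace_fjoin])
      qed
      then show ?thesis
        using T ST by (intro exI[of _ T]) simp
    qed
  qed (use proper in \<open>auto simp: subspace_homog subspace_place\<close>)
qed

end

section \<open>Relations in the lattice of a quadratic algebra\<close>

lemma UN_intervals:
  "2 \<le> N \<Longrightarrow> a \<le> b \<Longrightarrow> (\<Union>i\<in>{a..b}. {i..i + N - 2}) = {a..b + N - 2}" for a b N :: nat
proof
  assume ab: "2 \<le> N" "a \<le> b"
  show "{a..b + N - 2} \<subseteq> (\<Union>i\<in>{a..b}. {i..i + N - 2})"
  proof
    fix l assume "l \<in> {a..b + N - 2}"
    then have "min l b \<in> {a..b}" "l \<in> {min l b..min l b + N - 2}"
      using ab by (auto simp: min_def)
    then show "l \<in> (\<Union>i\<in>{a..b}. {i..i + N - 2})"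
      by blast
  qed
qed auto

context tensor_setting
begin

text \<open>
  Placing a subspace of \<open>V\<^bsup>\<otimes>N\<^esup>\<close> inside \<open>V\<^bsup>\<otimes>n\<^esup>\<close> is a lattice homomorphism and maps
  copies of \<open>R\<close> to copies of \<open>R\<close>.
\<close>

lemma relation_lattice_place:
  assumes R: "tsubspace R" "R \<subseteq> homog M" and R': "R' \<in> relation_lattice s B M R N"
  shows "tsubspace R' \<and> R' \<subseteq> homog N \<and>
    (\<forall>n. \<forall>i\<in>{1..n + 1 - N}. place s B N R' n i \<in> relation_lattice s B M R n)"
  using R' unfolding relation_lattice_def
proof (induction R')
  case (base Y)
  then obtain j where j: "j \<in> {1..N + 1 - M}" "Y = place s B M R N j"
    by blast
  have "place s B N Y n i \<in> lattice_gen (place s B M R n ` {1..n + 1 - M})"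
    if i: "i \<in> {1..n + 1 - N}" for n i
    unfolding j(2) place_place[OF R j(1) i] using i j(1)
    by (intro lattice_gen.base imageI) auto
  then show ?case
    using place_homog[OF R j(1)] j(2) by (simp add: subspace_place)
next
  case (inf Y Y')
  then show ?case
    by (auto simp: place_Int T.subspace_inter lattice_gen.inf)
next
  case (sum Y Y')
  have "Y + Y' \<subseteq> homog N"
    using sum.IH T.span_minimal[of "Y \<union> Y'" "homog N"] subspace_homog by (simp add: T.plus_eq_span)
  moreover have "tsubspace (Y + Y')"
    using sum.IH by (simp add: T.plus_eq_span)
  ultimately show ?case
    using sum.IH by (simp add: place_plus lattice_gen.sum)
qed

lemma distributive_algebra_of_lattice:
  assumes R: "tsubspace R" "R \<subseteq> homog 2" and K: "N_koszul s B 2 R"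
    and R': "R' \<in> relation_lattice s B 2 R N"
  shows "distributive_algebra s B N R'"
  unfolding distributive_algebra_def
proof
  fix n
  obtain \<beta> where \<beta>: "T.independent \<beta>"
    "\<forall>i\<in>{1..n - 1}. place s B 2 R n i \<in> T.coordinate_subspaces \<beta>"
    using koszul_imp_distributive_family[OF R K, of n] unfolding T.distributive_family_def by blast
  then have "relation_lattice s B 2 R n \<subseteq> T.coordinate_subspaces \<beta>"
    unfolding relation_lattice_def by (intro T.lattice_gen_coordinate) auto
  then have "relation_lattice s B N R' n \<subseteq> T.coordinate_subspaces \<beta>"
    using relation_lattice_place[OF R R'] unfolding relation_lattice_def[of s B N]
    by (intro T.lattice_gen_coordinate[OF \<beta>(1)]) blast
  then show "distributive_lattice (relation_lattice s B N R' n)"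
    by (rule T.distributive_lattice_coordinate[OF \<beta>(1)])
qed

lemma place_intersection:
  assumes R: "tsubspace R" "R \<subseteq> homog 2" and N: "2 \<le> N" and i: "i \<in> {1..n + 1 - N}"
  shows "place s B N (\<Inter>j\<in>{1..N - 1}. place s B 2 R N j) n i =
    T.fmeet (homog n) (place s B 2 R n) {i..i + N - 2}"
proof -
  have R2: "place s B 2 R N j \<subseteq> homog N" if "j \<in> {1..N - 1}" for j
    using place_homog[OF R, of j N] that by auto
  have "place s B N (\<Inter>j\<in>{1..N - 1}. place s B 2 R N j) n i =
      (\<Inter>j\<in>{1..N - 1}. place s B N (place s B 2 R N j) n i)"
    using R2 i N by (intro place_INT subspace_place) auto
  also have "\<dots> = (\<Inter>j\<in>{1..N - 1}. place s B 2 R n (i + j - 1))"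
    using place_place[OF R _ i] by auto
  also have "\<dots> = (\<Inter>l\<in>(\<lambda>j. i + j - 1) ` {1..N - 1}. place s B 2 R n l)"
    by (simp only: image_image)
  also have "(\<lambda>j. i + j - 1) ` {1..N - 1} = {i..i + N - 2}"
  proof
    show "{i..i + N - 2} \<subseteq> (\<lambda>j. i + j - 1) ` {1..N - 1}"
    proof
      fix l assume "l \<in> {i..i + N - 2}"
      then show "l \<in> (\<lambda>j. i + j - 1) ` {1..N - 1}"
        using N i by (intro image_eqI[of _ _ "l + 1 - i"]) auto
    qed
  qed (use N i in auto)
  also have "(\<Inter>l\<in>{i..i + N - 2}. place s B 2 R n l) = T.fmeet (homog n) (place s B 2 R n) {i..i + N - 2}"
  proof -
    have "i \<in> {1..n + 1 - 2}"
      using i N unfolding atLeastAtMost_iff by linarith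
    then have "place s B 2 R n i \<subseteq> homog n" "i \<in> {i..i + N - 2}"
      using place_homog[OF R] N by auto
    then show ?thesis
      unfolding T.fmeet_def by blast
  qed
  finally show ?thesis .
qed

lemma extra_condition_intersection:
  assumes R: "tsubspace R" "R \<subseteq> homog 2" and N: "2 \<le> N"
  shows "extra_condition s B N (\<Inter>j\<in>{1..N - 1}. place s B 2 R N j)"
  unfolding extra_condition_def
proof (intro allI impI)
  fix n i l j assume n: "N \<le> n" and ilj: "1 \<le> i \<and> i \<le> l \<and> l \<le> j \<and> j \<le> n + 1 - N \<and> j \<le> i + N - 1"
  then have *: "i \<in> {1..n + 1 - N}" "j \<in> {1..n + 1 - N}" "l \<in> {1..n + 1 - N}"
    by auto
  have "{l..l + N - 2} \<subseteq> {i..i + N - 2} \<union> {j..j + N - 2}"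
    using ilj by auto
  then show "place s B N (\<Inter>j\<in>{1..N - 1}. place s B 2 R N j) n i \<inter>
      place s B N (\<Inter>j\<in>{1..N - 1}. place s B 2 R N j) n j
      \<subseteq> place s B N (\<Inter>j\<in>{1..N - 1}. place s B 2 R N j) n l"
    unfolding place_intersection[OF R N *(1)] place_intersection[OF R N *(2)]
      place_intersection[OF R N *(3)] T.fmeet_def
    by blast
qed

text \<open>
  Let \<open>a < b < c\<close> be the degrees of three consecutive terms. All subspaces in \<open>graded_exact\<close> are meets of the \<open>X\<^sub>l\<close> over intervals, or joins of such meets,
  so the distributive law expands the left-hand side into the meets of \<open>VJ b D\<close> with the single
  copies \<open>X\<^sub>i \<inter> \<dots> \<inter> X\<^bsub>i+N-2\<^esub>\<close> of \<open>R'\<close>. If the copy ends before the last \<open>b\<close> factors, it is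
  contained in \<open>IV (D - b) D\<close>. Otherwise its interval of indices and the interval
  \<open>{D+1-b, \<dots>, D-1}\<close> that defines \<open>VJ b D\<close> leave no gap, so together they contain the interval
  that defines \<open>VJ c D\<close>.
\<close>

lemma N_koszul_intersection:
  assumes R: "tsubspace R" "R \<subseteq> homog 2" and K: "N_koszul s B 2 R" and N: "2 \<le> N"
    and R': "R' = (\<Inter>j\<in>{1..N - 1}. place s B 2 R N j)"
  shows "N_koszul s B N R'"
proof -
  have "place s B 2 R N j \<subseteq> homog N" if "j \<in> {1..N - 1}" for j
    using place_homog[OF R, of j N] that by auto
  moreover have "1 \<in> {1..N - 1}" using N by auto
  ultimately have "R' \<subseteq> homog N"
    unfolding R' by blast
  moreover have "tsubspace R'"
    unfolding R' by (intro T.subspace_Int subspace_place)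
  ultimately interpret Q: homogeneous_algebra s B N R'
    using N by unfold_locales
  have "Q.graded_exact"
    unfolding Q.graded_exact_def
  proof (intro allI impI)
    fix j D assume D: "Q.deg (Suc (Suc j)) \<le> D"
    let ?M = "T.fmeet (homog D) (place s B 2 R D)"
    define a b c where "a = Q.deg j" and "b = Q.deg (Suc j)" and "c = Q.deg (Suc (Suc j))"
    have c: "c = a + N" and bc: "b < c" and ab: "a < b" and cD: "c \<le> D"
      using D Q.deg_less[of j] Q.deg_less[of "Suc j"] unfolding a_def b_def c_def
      by (auto simp: koszul_degree_step)
    have b: "b = 1 \<or> N \<le> b"
    proof (cases j)
      case 0
      then show ?thesis by (simp add: b_def)
    next
      case (Suc i)
      then show ?thesis by (simp add: b_def koszul_degree_step)
    qed
    have X: "Q.X D i = ?M {i..i + N - 2}" if "i \<in> {1..D + 1 - N}" for i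
      using place_intersection[OF R N that] unfolding R' .
    have VJ: "Q.VJ n D = ?M {D + 1 - n..D - 1}" if n: "n = 1 \<or> N \<le> n" "n \<le> D" for n
    proof (cases "n = 1")
      case True
      then show ?thesis
        using N n unfolding Q.VJ_def T.fmeet_def by simp
    next
      case False
      then have n: "N \<le> n" "n \<le> D" using that by auto
      have "Q.X D i = ?M {i..i + N - 2}" if "i \<in> {D + 1 - n..D + 1 - N}" for i
        using that n by (intro X) auto
      then have "(\<Inter>i\<in>{D + 1 - n..D + 1 - N}. Q.X D i) =
          (\<Inter>i\<in>{D + 1 - n..D + 1 - N}. ?M {i..i + N - 2})"
        by (rule INF_cong[OF refl])
      then have "Q.VJ n D = homog D \<inter> (\<Inter>i\<in>{D + 1 - n..D + 1 - N}. ?M {i..i + N - 2})"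
        unfolding Q.VJ_def T.fmeet_def by (simp only:)
      also have "\<dots> = ?M (\<Union>i\<in>{D + 1 - n..D + 1 - N}. {i..i + N - 2})"
        unfolding T.fmeet_def by auto
      also have "(\<Union>i\<in>{D + 1 - n..D + 1 - N}. {i..i + N - 2}) = {D + 1 - n..D - 1}"
        using n N by (subst UN_intervals) auto
      finally show ?thesis .
    qed
    obtain \<beta> where \<beta>: "T.independent \<beta>" "tspan \<beta> = homog D"
      "\<forall>i\<in>{1..D - 1}. place s B 2 R D i \<in> T.coordinate_subspaces \<beta>"
      using koszul_imp_distributive_family[OF R K, of D] unfolding T.distributive_family_def by blast
    have M: "?M P \<in> T.coordinate_subspaces \<beta>" if "P \<subseteq> {1..D - 1}" for P
      unfolding T.fmeet_def using that \<beta> finite_subset[OF that]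
      by (intro T.coordinate_INT) auto
    have Zb: "Q.VJ b D = ?M {D + 1 - b..D - 1}" and Zc: "Q.VJ c D = ?M {D + 1 - c..D - 1}"
      using b bc cD c by (intro VJ; simp)+
    have "Q.VJ b D \<inter> Q.IV (D - a) D = T.fjoin (\<lambda>i. Q.VJ b D \<inter> Q.X D i) {1..D - a + 1 - N}"
      unfolding Q.IV_def T.fjoin_def
    proof (rule T.coordinate_distrib[OF \<beta>(1)])
      show "Q.VJ b D \<in> T.coordinate_subspaces \<beta>"
        unfolding Zb using bc cD by (intro M) auto
      show "Q.X D i \<in> T.coordinate_subspaces \<beta>" if "i \<in> {1..D - a + 1 - N}" for i
      proof -
        have "1 \<le> i" "i \<le> D + 1 - N" "i + N - 2 \<le> D - 1"
          using that N unfolding atLeastAtMost_iff by linarith+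
        then have iD: "i \<in> {1..D + 1 - N}" and sub: "{i..i + N - 2} \<subseteq> {1..D - 1}"
          by auto
        show ?thesis
          unfolding X[OF iD] by (rule M[OF sub])
      qed
    qed
    also have "\<dots> \<subseteq> Q.VJ c D + Q.IV (D - b) D"
      unfolding T.fjoin_def
    proof (rule T.span_minimal, rule UN_least)
      show "tsubspace (Q.VJ c D + Q.IV (D - b) D)"
        by (simp add: T.plus_eq_span Q.subspace_VJ Q.subspace_IV)
      fix i assume i: "i \<in> {1..D - a + 1 - N}"
      show "Q.VJ b D \<inter> Q.X D i \<subseteq> Q.VJ c D + Q.IV (D - b) D"
      proof (cases "i \<le> D - b + 1 - N")
        case True
        then have "Q.X D i \<subseteq> Q.IV (D - b) D"
          unfolding Q.IV_def T.fjoin_def using i True by (intro order_trans[OF _ T.span_superset]) auto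
        also have "\<dots> \<subseteq> Q.VJ c D + Q.IV (D - b) D"
          using T.subspace_0[OF Q.subspace_VJ] by (rule set_zero_plus2)
        finally show ?thesis by blast
      next
        case False
        have iD: "i \<in> {1..D + 1 - N}"
          using i unfolding atLeastAtMost_iff by linarith
        have "i \<le> D + 1 - c" "D + 1 - b \<le> i + N - 2 + 1"
          using False i N ab bc cD c unfolding atLeastAtMost_iff by linarith+
        then have "{D + 1 - c..D - 1} \<subseteq> {i..i + N - 2} \<union> {D + 1 - b..D - 1}"
          by auto
        then have "Q.VJ b D \<inter> Q.X D i \<subseteq> Q.VJ c D"
          unfolding Zb Zc X[OF iD] T.fmeet_def by blast
        also have "\<dots> \<subseteq> Q.VJ c D + Q.IV (D - b) D"
          using set_zero_plus2[OF T.subspace_0[OF Q.subspace_IV[of "D - b" D]], of "Q.VJ c D"]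
          by (simp only: add.commute[of "Q.VJ c D"])
        finally show ?thesis .
      qed
    qed
    finally show "Q.VJ (Q.deg (Suc j)) D \<inter> Q.IV (D - Q.deg j) D
        \<subseteq> Q.VJ (Q.deg (Suc (Suc j))) D + Q.IV (D - Q.deg (Suc j)) D"
      unfolding a_def b_def c_def .
  qed
  then show ?thesis
    using Q.N_koszul_iff by simp
qed

end

theorem proposition6p1p1:
  fixes s :: "'k::field \<Rightarrow> 'v::ab_group_add \<Rightarrow> 'v" and B :: "'v set"
    and R R' :: "('v, 'k) tensor set" and N :: nat
  assumes "finite_dimensional_vector_space s B"
    and "tsubspace R" and "R \<subseteq> Vpow s B 2"
    and "N_koszul s B 2 R"
    and "N \<ge> 2"
    and "R' \<in> relation_lattice s B 2 R N"
  shows "distributive_algebra s B N R' \<and>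
    (R' = (\<Inter>i\<in>{1..N - 1}. place s B 2 R N i) \<longrightarrow>
      extra_condition s B N R' \<and> N_koszul s B N R')"
proof -
  interpret tensor_setting s B
    using assms(1) by (rule tensor_setting.intro)
  have R: "tsubspace R" "R \<subseteq> homog 2"
    using assms(2,3) by (simp_all only: Vpow_eq)
  show ?thesis
    using distributive_algebra_of_lattice[OF R assms(4,6)]
      extra_condition_intersection[OF R assms(5)] N_koszul_intersection[OF R assms(4,5)] by simp
qed

end
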